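(* Let $m,n\ge 2$ and let $S=S(m,n;\underline{t})$ be the special Lie superalgebra over a field $\mathbb{F}$ of characteristic $p>2$. Let $\phi$ be a skew-symmetric super-biderivation of $S$. For any $k_0\in Y_0$, $k_1,i_1\in Y_1$ with $i_1\neq k_1$, there is an element $\mu_{k_0k_1}\in\mathbb{F}$, depending (for given $\phi$) only on $k_0$ and $k_1$, such that $$\phi(D_{k_0k_1}(x_{k_0}x_{k_1}),D_{k_1i_1}(x_{i_1}))=\mu_{k_0k_1}[D_{k_0k_1}(x_{k_0}x_{k_1}),D_{k_1i_1}(x_{i_1})].$$
   Context: Conventions. $\mathbb{F}$ is a field of characteristic $p>2$; $\mathbb{Z}_2=\{\bar 0,\bar 1\}$; $\mathrm{d}(x)$ denotes the $\mathbb{Z}_2$-degree (parity) of $x$, and whenever $\mathrm{d}(x)$ appears, $x$ is assumed $\mathbb{Z}_2$-homogeneous. A Lie superalgebra is a superspace $L=L_{\bar 0}\oplus L_{\bar 1}$ with an even bilinear bracket satisfying $[x,y]=-(-1)^{\mathrm{d}(x)\mathrm{d}(y)}[y,x]$ and $[x,[y,z]]=[[x,y],z]+(-1)^{\mathrm{d}(x)\mathrm{d}(y)}[y,[x,z]]$. Super-biderivations. A bilinear map $\phi:L\times L\to L$ is $\mathbb{Z}_2$-homogeneous of degree $\gamma=\mathrm{d}(\phi)\in\mathbb{Z}_2$ if $\phi(L_\alpha,L_\beta)\subset L_{\alpha+\beta+\gamma}$ for all $\alpha,\beta\in\mathbb{Z}_2$. A homogeneous bilinear map $\phi$ is a skew-symmetric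 super-biderivation of $L$ if for all homogeneous $x,y,z\in L$ $$\phi(x,[y,z])=[\phi(x,y),z]+(-1)^{(\mathrm{d}(\phi)+\mathrm{d}(x))\mathrm{d}(y)}[y,\phi(x,z)],$$ $$\phi(x,y)=-(-1)^{\mathrm{d}(\phi)\mathrm{d}(x)+\mathrm{d}(\phi)\mathrm{d}(y)+\mathrm{d}(x)\mathrm{d}(y)}\phi(y,x).$$ The algebra $S(m,n;\underline{t})$. Let $\underline{t}=(t_1,\dots,t_m)$ be an $m$-tuple of positive integers, $s=m+n$, $Y_0=\{1,\dots,m\}$, $Y_1=\{m+1,\dots,s\}$, $Y=Y_0\cup Y_1$, and $\tau(i)=\bar 0$ for $i\in Y_0$, $\tau(i)=\bar 1$ for $i\in Y_1$. Let $\pi_i=p^{t_i}-1$ and $A=\{\alpha\in\mathbb{N}^m\mid 0\le\alpha_i\le\pi_i\}$; let $B$ be the set of strictly increasing tuples $u=\langle i_1,\dots,i_k\rangle$ in $Y_1$ ($0\le k\le n$), with $x^u=x_{i_1}\cdots x_{i_k}$ and $x^{\varnothing}=1$. Let $\Lambda(m,n;\underline{t})$ be the associative superalgebra with basis $\{x^{(\alpha)}x^u\mid\alpha\in A,u\in B\}$, where $x^{(\alpha)}x^{(\beta)}=\binom{\alpha+\beta}{\alpha}x^{(\alpha+\beta)}$ with $\binom{\alpha}{\beta}=\prod_i\binom{\alpha_i}{\beta_i}$ (the product is $0$ when $\alpha+\beta\notin A$), $x_ix_j=-x_jx_i$ for $i,j\in Y_1$ (so $x_i^2=0$), $x^{(\alpha)}x_j=x_jx^{(\alpha)}$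 for $j\in Y_1$; the $x^{(\alpha)}$ are even and the $x_j$, $j\in Y_1$, odd. For $i\in Y_0$ write $x_i=x^{(\varepsilon_i)}$, with $\varepsilon_i$ the $i$-th unit vector. Let $D_i$ ($i\in Y$) be the superderivation of parity $\tau(i)$ given by $D_i(x^{(\alpha)}x^u)=x^{(\alpha-\varepsilon_i)}x^u$ for $i\in Y_0$ (zero if $\alpha_i=0$), and $D_i(x^{(\alpha)}x^u)=x^{(\alpha)}\partial_i(x^u)$ for $i\in Y_1$, where $\partial_i$ is the odd superderivation of the Grassmann algebra with $\partial_i(x_j)=\delta_{ij}$. Let $W(m,n;\underline{t})=\{\sum_{i\in Y}f_iD_i\mid f_i\in\Lambda(m,n;\underline{t})\}$ with bracket $[fD_i,gD_j]=fD_i(g)D_j-(-1)^{\mathrm{d}(fD_i)\mathrm{d}(gD_j)}gD_j(f)D_i$. For $i,j\in Y$ and homogeneous $f\in\Lambda(m,n;\underline{t})$ put $$D_{ij}(f)=-(-1)^{\mathrm{d}(f)(\tau(i)+\tau(j))}D_j(f)D_i+(-1)^{\tau(i)\tau(j)}D_i(f)D_j,$$ extended linearly in $f$. Then $S=S(m,n;\underline{t})=\mathrm{span}_{\mathbb{F}}\{D_{ij}(f)\mid i,j\in Y,\ f\in\Lambda(m,n;\underline{t})\}$, a finite-dimensional simple Lie sub-superalgebra of $W(m,n;\underline{t})$. *)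

theory Defs
  imports Complex_Main "HOL-Library.Z2" "HOL-Library.Function_Algebras"
begin

text \<open>
  \<open>\<int>\<^sub>2\<close> is the field \<^typ>\<open>bit\<close>, and \<open>ssign d\<close> is \<open>(-1)\<^sup>d\<close>.
\<close>

definition ssign :: "bit \<Rightarrow> 'a::ring_1" where
  "ssign d = (if d = 0 then 1 else - 1)"


section \<open>Skew-symmetric super-biderivations\<close>

text \<open>
  A superalgebra inside a vector space with scalar multiplication \<open>scale\<close> is given by its underlying
  subspace \<open>L\<close>, its homogeneous components \<open>G 0\<close> and \<open>G 1\<close>, and its bracket \<open>br\<close>. Maps
  \<open>L \<times> L \<rightarrow> L\<close> are total functions of which only the values on \<open>L\<close> matter. As the zero vector lies
  in both components, "for all homogeneous x" is rendered as "for all \<open>\<alpha>\<close> and all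
  \<open>x \<in> G \<alpha>\<close>", with \<open>\<alpha>\<close> in the role of \<open>d(x)\<close>.
\<close>

definition bilinear_on ::
  "('a::field \<Rightarrow> 'v::ab_group_add \<Rightarrow> 'v) \<Rightarrow> 'v set \<Rightarrow> ('v \<Rightarrow> 'v \<Rightarrow> 'v) \<Rightarrow> bool" where
  "bilinear_on scale L \<phi> \<longleftrightarrow>
     (\<forall>x\<in>L. \<forall>y\<in>L. \<phi> x y \<in> L) \<and>
     (\<forall>x\<in>L. \<forall>y\<in>L. \<forall>z\<in>L. \<phi> (x + y) z = \<phi> x z + \<phi> y z \<and> \<phi> x (y + z) = \<phi> x y + \<phi> x z) \<and>
     (\<forall>c. \<forall>x\<in>L. \<forall>y\<in>L. \<phi> (scale c x) y = scale c (\<phi> x y) \<and> \<phi> x (scale c y) = scale c (\<phi> x y))"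

definition homogeneous_bilinear ::
  "('a::field \<Rightarrow> 'v::ab_group_add \<Rightarrow> 'v) \<Rightarrow> 'v set \<Rightarrow> (bit \<Rightarrow> 'v set) \<Rightarrow> bit \<Rightarrow> ('v \<Rightarrow> 'v \<Rightarrow> 'v) \<Rightarrow> bool" where
  "homogeneous_bilinear scale L G \<gamma> \<phi> \<longleftrightarrow>
     bilinear_on scale L \<phi> \<and>
     (\<forall>\<alpha> \<beta>. \<forall>x\<in>G \<alpha>. \<forall>y\<in>G \<beta>. \<phi> x y \<in> G (\<alpha> + \<beta> + \<gamma>))"

definition skew_super_biderivation ::
  "('a::field \<Rightarrow> 'v::ab_group_add \<Rightarrow> 'v) \<Rightarrow> 'v set \<Rightarrow> (bit \<Rightarrow> 'v set) \<Rightarrow> ('v \<Rightarrow> 'v \<Rightarrow> 'v) \<Rightarrow>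
     bit \<Rightarrow> ('v \<Rightarrow> 'v \<Rightarrow> 'v) \<Rightarrow> bool" where
  "skew_super_biderivation scale L G br \<gamma> \<phi> \<longleftrightarrow>
     homogeneous_bilinear scale L G \<gamma> \<phi> \<and>
     (\<forall>\<alpha> \<beta> \<delta>. \<forall>x\<in>G \<alpha>. \<forall>y\<in>G \<beta>. \<forall>z\<in>G \<delta>.
        \<phi> x (br y z) = br (\<phi> x y) z + scale (ssign ((\<gamma> + \<alpha>) * \<beta>)) (br y (\<phi> x z))) \<and>
     (\<forall>\<alpha> \<beta>. \<forall>x\<in>G \<alpha>. \<forall>y\<in>G \<beta>.
        \<phi> x y = - scale (ssign (\<gamma> * \<alpha> + \<gamma> * \<beta> + \<alpha> * \<beta>)) (\<phi> y x))"


section \<open>The superalgebra \<open>\<Lambda>(m,n;t)\<close>\<close>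

text \<open>
  The basis element \<open>x\<^sup>(\<^sup>\<alpha>\<^sup>) x\<^sup>u\<close> is represented by the pair \<open>(\<alpha>, u)\<close>, where the multi-index \<open>\<alpha>\<close>
  vanishes outside \<open>{1..m}\<close> and the strictly increasing tuple \<open>u\<close> is identified with the set of its
  entries. An element of \<open>\<Lambda>(m,n;t)\<close> is its coefficient function with respect to this basis.
  Addition of such functions is pointwise; their product is \<open>lmult\<close> below and not the pointwise
  product.
\<close>

type_synonym idx = "(nat \<Rightarrow> nat) \<times> nat set"
type_synonym 'a lam = "idx \<Rightarrow> 'a"

definition lscale :: "'a::field \<Rightarrow> 'a lam \<Rightarrow> 'a lam" where
  "lscale c f = (\<lambda>k. c * f k)"

definition bmono :: "idx \<Rightarrow> 'a::field lam" where
  "bmono k = (\<lambda>l. if l = k then 1 else 0)"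

definition eps :: "nat \<Rightarrow> nat \<Rightarrow> nat" where
  "eps i = (\<lambda>j. if j = i then 1 else 0)"

definition idx_parity :: "idx \<Rightarrow> bit" where
  "idx_parity k = of_nat (card (snd k))"

text \<open>The component of parity \<open>d\<close> of an element of \<open>\<Lambda>(m,n;t)\<close>.\<close>

definition hpart :: "bit \<Rightarrow> 'a::field lam \<Rightarrow> 'a lam" where
  "hpart d f = (\<lambda>k. if idx_parity k = d then f k else 0)"

text \<open>
  For disjoint \<open>u\<close> and \<open>v\<close>, sorting the factors of \<open>x\<^sup>u x\<^sup>v\<close> takes one transposition for each pair
  \<open>(i, j) \<in> u \<times> v\<close> with \<open>j < i\<close>. The odd superderivation \<open>\<partial>\<^sub>i\<close> first moves \<open>x\<^sub>i\<close> to the front of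
  \<open>x\<^sup>u\<close>, past the factors with smaller index.
\<close>

definition grass_sign :: "nat set \<Rightarrow> nat set \<Rightarrow> 'a::field" where
  "grass_sign u v = (- 1) ^ card {(i, j). i \<in> u \<and> j \<in> v \<and> j < i}"

context
  fixes p m n :: nat and t :: "nat \<Rightarrow> nat"
begin

definition Y0 :: "nat set" where "Y0 = {1..m}"
definition Y1 :: "nat set" where "Y1 = {m + 1..m + n}"
definition Yall :: "nat set" where "Yall = Y0 \<union> Y1"

definition tau :: "nat \<Rightarrow> bit" where
  "tau i = (if i \<in> Y0 then 0 else 1)"

definition multi_idx :: "(nat \<Rightarrow> nat) set" where
  "multi_idx = {\<alpha>. (\<forall>i\<in>Y0. \<alpha> i \<le> p ^ t i - 1) \<and> (\<forall>i. i \<notin> Y0 \<longrightarrow> \<alpha> i = 0)}"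

definition basis_idx :: "idx set" where
  "basis_idx = multi_idx \<times> Pow Y1"

definition Lam :: "'a::field lam set" where
  "Lam = {f. \<forall>k. k \<notin> basis_idx \<longrightarrow> f k = 0}"

definition Lam_hom :: "bit \<Rightarrow> 'a::field lam set" where
  "Lam_hom d = {f \<in> Lam. \<forall>k. f k \<noteq> 0 \<longrightarrow> idx_parity k = d}"

definition bmono_mult :: "idx \<Rightarrow> idx \<Rightarrow> 'a::field lam" where
  "bmono_mult = (\<lambda>(\<alpha>, u) (\<beta>, v).
     if \<alpha> + \<beta> \<in> multi_idx \<and> u \<inter> v = {}
     then lscale (of_nat (\<Prod>i\<in>Y0. (\<alpha> i + \<beta> i) choose \<alpha> i) * grass_sign u v) (bmono (\<alpha> + \<beta>, u \<union> v))
     else 0)"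

definition lmult :: "'a::field lam \<Rightarrow> 'a lam \<Rightarrow> 'a lam" where
  "lmult f g = (\<Sum>k\<in>basis_idx. \<Sum>l\<in>basis_idx. lscale (f k * g l) (bmono_mult k l))"

definition gen :: "nat \<Rightarrow> 'a::field lam" where
  "gen i = (if i \<in> Y0 then bmono (eps i, {}) else bmono (0, {i}))"

definition D_bmono :: "nat \<Rightarrow> idx \<Rightarrow> 'a::field lam" where
  "D_bmono i = (\<lambda>(\<alpha>, u).
     if i \<in> Y0 then (if \<alpha> i = 0 then 0 else bmono (\<alpha>(i := \<alpha> i - 1), u))
     else (if i \<in> u then lscale ((- 1) ^ card {j \<in> u. j < i}) (bmono (\<alpha>, u - {i})) else 0))"

definition Dop :: "nat \<Rightarrow> 'a::field lam \<Rightarrow> 'a lam" where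
  "Dop i f = (\<Sum>k\<in>basis_idx. lscale (f k) (D_bmono i k))"

end


section \<open>The Lie superalgebras \<open>W(m,n;t)\<close> and \<open>S(m,n;t)\<close>\<close>

text \<open>
  The \<open>D\<^sub>i\<close> are linearly independent over \<open>\<Lambda>(m,n;t)\<close>, so \<open>\<Sum>\<^sub>i f\<^sub>i D\<^sub>i\<close> is represented by the family of
  its coefficients \<open>f\<^sub>i\<close>.
\<close>

type_synonym 'a sder = "nat \<Rightarrow> 'a lam"

definition wscale :: "'a::field \<Rightarrow> 'a sder \<Rightarrow> 'a sder" where
  "wscale c X = (\<lambda>i. lscale c (X i))"

global_interpretation sder: vector_space "wscale :: 'a::field \<Rightarrow> 'a sder \<Rightarrow> 'a sder"
  by unfold_locales (auto simp: wscale_def lscale_def fun_eq_iff algebra_simps)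

text \<open>\<open>fD f i\<close> is the superderivation \<open>f D\<^sub>i\<close>.\<close>

definition fD :: "'a::field lam \<Rightarrow> nat \<Rightarrow> 'a sder" where
  "fD f i = (\<lambda>j. if j = i then f else 0)"

context
  fixes p m n :: nat and t :: "nat \<Rightarrow> nat"
begin

definition W_alg :: "'a::field sder set" where
  "W_alg = {X. (\<forall>i\<in>Yall m n. X i \<in> Lam p m n t) \<and> (\<forall>i. i \<notin> Yall m n \<longrightarrow> X i = 0)}"

definition W_hom :: "bit \<Rightarrow> 'a::field sder set" where
  "W_hom d = {X \<in> W_alg. \<forall>i\<in>Yall m n. X i \<in> Lam_hom p m n t (d + tau m i)}"

text \<open>
  \<open>[f D\<^sub>i, g D\<^sub>j]\<close> for \<open>f\<close> of parity \<open>a\<close> and \<open>g\<close> of parity \<open>b\<close>, and its bilinear extension to all of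
  \<open>W(m,n;t)\<close>.
\<close>

definition term_bracket ::
  "bit \<Rightarrow> 'a::field lam \<Rightarrow> nat \<Rightarrow> bit \<Rightarrow> 'a lam \<Rightarrow> nat \<Rightarrow> 'a sder" where
  "term_bracket a f i b g j =
     fD (lmult p m n t f (Dop p m n t i g)) j
     - wscale (ssign ((a + tau m i) * (b + tau m j))) (fD (lmult p m n t g (Dop p m n t j f)) i)"

definition bracket :: "'a::field sder \<Rightarrow> 'a sder \<Rightarrow> 'a sder" where
  "bracket X Z = (\<Sum>i\<in>Yall m n. \<Sum>j\<in>Yall m n. \<Sum>a\<in>{0, 1}. \<Sum>b\<in>{0, 1}.
     term_bracket a (hpart a (X i)) i b (hpart b (Z j)) j)"

definition Dij_hom :: "nat \<Rightarrow> nat \<Rightarrow> bit \<Rightarrow> 'a::field lam \<Rightarrow> 'a sder" where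
  "Dij_hom i j d f =
     - wscale (ssign (d * (tau m i + tau m j))) (fD (Dop p m n t j f) i)
     + wscale (ssign (tau m i * tau m j)) (fD (Dop p m n t i f) j)"

definition Dij :: "nat \<Rightarrow> nat \<Rightarrow> 'a::field lam \<Rightarrow> 'a sder" where
  "Dij i j f = (\<Sum>d\<in>{0, 1}. Dij_hom i j d (hpart d f))"

definition S_alg :: "'a::field sder set" where
  "S_alg = sder.span {Dij i j f | i j f. i \<in> Yall m n \<and> j \<in> Yall m n \<and> f \<in> Lam p m n t}"

definition S_hom :: "bit \<Rightarrow> 'a::field sder set" where
  "S_hom d = S_alg \<inter> W_hom d"

end

end

theory Submission
  imports Defs
begin

text \<open>
  Since \<open>D\<^sub>k\<^sub>1\<^sub>i\<^sub>1(x\<^sub>i\<^sub>1) = - D\<^sub>k\<^sub>1\<close> for every admissible \<open>i\<^sub>1\<close>, and \<open>h = D\<^sub>k\<^sub>0\<^sub>k\<^sub>1(x\<^sub>k\<^sub>0x\<^sub>k\<^sub>1) = x\<^sub>k\<^sub>0D\<^sub>k\<^sub>0 + x\<^sub>k\<^sub>1D\<^sub>k\<^sub>1\<close>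
  satisfies \<open>[h, D\<^sub>k\<^sub>1] = - D\<^sub>k\<^sub>1\<close>, the claim is that \<open>P = \<phi>(h, D\<^sub>k\<^sub>1)\<close> is a multiple of \<open>D\<^sub>k\<^sub>1\<close>.
  The tool is the identity \<open>[\<phi>(x, y), [u, v]] = \<plusminus>[[x, y], \<phi>(u, v)]\<close>.

  For \<open>a \<noteq> b\<close> and \<open>a \<noteq> k\<^sub>1\<close> it shows that \<open>\<phi>(x\<^sub>aD\<^sub>b, D\<^sub>k\<^sub>1)\<close> commutes with all
  \<open>x\<^sub>cD\<^sub>d = [x\<^sub>cD\<^sub>e, x\<^sub>eD\<^sub>d]\<close>, \<open>c \<noteq> d\<close> (with \<open>x\<^sub>c = 1\<close> allowed), hence vanishes. The identity with
  \<open>u = x\<^sub>aD\<^sub>c\<close> and \<open>v = x\<^sub>cD\<^sub>b\<close>, where \<open>a, b, c \<noteq> k\<^sub>1\<close>, then gives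
  \<open>[P, x\<^sub>aD\<^sub>b] = \<plusminus>[D\<^sub>k\<^sub>1, \<phi>(u, v)] = 0\<close>, while \<open>[P, D\<^sub>k\<^sub>1] = 0\<close> follows from
  \<open>[D\<^sub>k\<^sub>1, D\<^sub>k\<^sub>1] = 0\<close>. Commuting with all \<open>D\<^sub>b\<close> forces \<open>P\<close> to have constant coefficients, and
  commuting with \<open>x\<^sub>aD\<^sub>b\<close> kills the coefficient of \<open>D\<^sub>a\<close>.
  Only the Jacobi identity for two vector fields of degree at most \<open>0\<close> and an arbitrary third one
  is needed.
\<close>

section \<open>A bracket identity for super-biderivations\<close>

text \<open>By default the simplifier turns sums and products of bits into XOR and AND.\<close>

declare add_bit_eq_xor [simp del] mult_bit_eq_and [simp del]

lemma bit_cases: "(a::bit) = 0 \<or> a = 1"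
  by (cases a) auto

text \<open>
  The Jacobi identity is only assumed when two of the entries lie in \<open>B\<close>; in the application these
  are vector fields with affine coefficients, the third entry being a value of \<open>\<phi>\<close>.
\<close>

locale super_biderivation = vector_space scale
  for scale :: "'a::field \<Rightarrow> 'v::ab_group_add \<Rightarrow> 'v" +
  fixes L :: "'v set" and G W B :: "bit \<Rightarrow> 'v set" and br \<phi> :: "'v \<Rightarrow> 'v \<Rightarrow> 'v" and \<gamma> :: bit
  assumes biderivation: "skew_super_biderivation scale L G br \<gamma> \<phi>"
    and br_add_left: "br (x + y) z = br x z + br y z"
    and br_add_right: "br x (y + z) = br x y + br x z"
    and br_scale_left: "br (scale k x) y = scale k (br x y)"
    and br_scale_right: "br x (scale k y) = scale k (br x y)"
    and br_closed: "\<lbrakk>x \<in> W a; y \<in> W b\<rbrakk> \<Longrightarrow> br x y \<in> W (a + b)"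
    and br_skew: "\<lbrakk>x \<in> W a; y \<in> W b\<rbrakk> \<Longrightarrow> br x y = - scale (ssign (a * b)) (br y x)"
    and jacobi: "\<lbrakk>x \<in> B a; y \<in> B b; z \<in> W c\<rbrakk> \<Longrightarrow>
      br x (br y z) = br (br x y) z + scale (ssign (a * b)) (br y (br x z))"
    and G_le_W: "G a \<subseteq> W a"
    and B_le_G: "B a \<subseteq> G a"
    and br_B: "\<lbrakk>x \<in> B a; y \<in> B b\<rbrakk> \<Longrightarrow> br x y \<in> G (a + b)"
begin

lemma br_minus: "br (- x) y = - br x y" "br x (- y) = - br x y"
  using br_scale_left[of "-1" x y] br_scale_right[of x "-1" y] by simp_all

lemma br_diff: "br (x - y) z = br x z - br y z" "br x (y - z) = br x y - br x z"
  using br_add_left[of x "- y" z] br_add_right[of x y "- z"] by (simp_all add: br_minus)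

lemma br_zero: "br 0 y = 0" "br x 0 = 0"
  using br_diff(1)[of 0 0 y] br_diff(2)[of x 0 0] by simp_all

lemma phi_deg: "\<lbrakk>x \<in> G a; y \<in> G b\<rbrakk> \<Longrightarrow> \<phi> x y \<in> G (a + b + \<gamma>)"
  and phi_der: "\<lbrakk>x \<in> G a; y \<in> G b; z \<in> G c\<rbrakk> \<Longrightarrow>
      \<phi> x (br y z) = br (\<phi> x y) z + scale (ssign ((\<gamma> + a) * b)) (br y (\<phi> x z))"
  and phi_skew: "\<lbrakk>x \<in> G a; y \<in> G b\<rbrakk> \<Longrightarrow>
      \<phi> x y = - scale (ssign (\<gamma> * a + \<gamma> * b + a * b)) (\<phi> y x)"
  using biderivation unfolding skew_super_biderivation_def homogeneous_bilinear_def by blast+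

text \<open>The bracket identity says that this difference vanishes. \<open>v\<close> stays fixed
  while the first three arguments are permuted.\<close>

definition defect :: "bit \<Rightarrow> bit \<Rightarrow> 'v \<Rightarrow> 'v \<Rightarrow> 'v \<Rightarrow> 'v \<Rightarrow> 'v" where
  "defect b c x y u v = br (\<phi> x y) (br u v) - scale (ssign (\<gamma> * (b + c))) (br (br x y) (\<phi> u v))"

lemma scale_ssign: "scale (ssign d) x = (if d = 0 then x else - x)"
  by (simp add: ssign_def)

text \<open>Rewrite rules to a normal form: every double bracket of \<open>z\<close> with
  \<open>u\<close> and \<open>v\<close> becomes a combination of \<open>br u (br v z)\<close> and
  \<open>br v (br u z)\<close>.\<close>

lemma br_W_B_B:
  assumes "z \<in> W c" "u \<in> B a" "v \<in> B b"
  shows "br (br z u) v = scale (ssign (a * c + b * (a + c))) (br v (br u z))"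
    and "br u (br z v) = - scale (ssign (b * c)) (br u (br v z))"
    and "br (br u z) v = - scale (ssign (b * (a + c))) (br v (br u z))"
    and "br (br u v) z = br u (br v z) - scale (ssign (a * b)) (br v (br u z))"
    and "br z (br u v) = - scale (ssign (c * (a + b))) (br u (br v z) - scale (ssign (a * b)) (br v (br u z)))"
proof -
  have W: "u \<in> W a" "v \<in> W b" using assms B_le_G G_le_W by blast+
  note s = br_skew[OF assms(1) W(1)] br_skew[OF assms(1) W(2)]
    br_skew[OF br_closed[OF assms(1) W(1)] W(2)] br_skew[OF br_closed[OF W(1) assms(1)] W(2)]
    br_skew[OF assms(1) br_closed[OF W]]
  show 4: "br (br u v) z = br u (br v z) - scale (ssign (a * b)) (br v (br u z))"
    using jacobi[OF assms(2,3,1)] by simp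
  show "br u (br z v) = - scale (ssign (b * c)) (br u (br v z))"
    by (simp add: s br_minus br_scale_right mult.commute)
  show "br (br u z) v = - scale (ssign (b * (a + c))) (br v (br u z))"
    by (simp add: s mult.commute)
  show "br z (br u v) = - scale (ssign (c * (a + b))) (br u (br v z) - scale (ssign (a * b)) (br v (br u z)))"
    using s(5) 4 by simp
  show "br (br z u) v = scale (ssign (a * c + b * (a + c))) (br v (br u z))"
    using bit_cases[of a] bit_cases[of b] bit_cases[of c] s
    by (elim disjE) (simp_all add: scale_ssign br_minus)
qed

text \<open>The value \<open>\<phi> (br x u) (br y v)\<close> can be expanded in two orders; up to
  sign, the mismatch of the two expansions is the difference of the two defects.\<close>

lemma defect_swap13:
  assumes x: "x \<in> B a" and y: "y \<in> B b" and u: "u \<in> B c" and v: "v \<in> B d"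
  shows "defect b c x y u v = scale (ssign (a * c + (a + c) * (\<gamma> + b))) (defect b a u y x v)"
proof -
  have g: "x \<in> G a" "y \<in> G b" "u \<in> G c" "v \<in> G d" using assms B_le_G by blast+
  note B = br_B[OF x u] br_B[OF y v]
  have W: "\<phi> x y \<in> W (a + b + \<gamma>)" "\<phi> x v \<in> W (a + d + \<gamma>)" 
    "\<phi> u y \<in> W (c + b + \<gamma>)" "\<phi> u v \<in> W (c + d + \<gamma>)"
    using phi_deg g G_le_W by blast+
  note K = phi_skew[OF g(2,1)] phi_skew[OF g(4,1)] phi_skew[OF g(2,3)] phi_skew[OF g(4,3)]
  note E1 = phi_der[OF B(1) g(2,4)] phi_skew[OF B(1) g(2)] phi_skew[OF B(1) g(4)]
     phi_der[OF g(2) g(1,3)] phi_der[OF g(4) g(1,3)]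
  note E2 = phi_der[OF B(2) g(1,3)] phi_skew[OF B(2) g(1)] phi_skew[OF B(2) g(3)]
     phi_der[OF g(1) g(2,4)] phi_der[OF g(3) g(2,4)]
  note R = br_W_B_B[OF W(1) u v] br_W_B_B[OF W(1) v u] br_W_B_B[OF W(2) u y] br_W_B_B[OF W(2) y u]
    br_W_B_B[OF W(3) x v] br_W_B_B[OF W(3) v x] br_W_B_B[OF W(4) x y] br_W_B_B[OF W(4) y x]
  txt \<open>Both sides are expanded by the derivation rule, starting with \<open>[y, v]\<close> and with \<open>[x, u]\<close>, respectively.\<close>
  have q: "\<phi> (br x u) (br y v) = - scale (ssign (\<gamma> * (a + c) + \<gamma> * (b + d) + (a + c) * (b + d))) (\<phi> (br y v) (br x u))"
    by (rule phi_skew[OF B])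
  \<comment> \<open>The right-hand side is zero by \<open>q\<close> and is left unsimplified, so
    that its two terms can be expanded by the different rules \<open>E1\<close> and
    \<open>E2\<close>. The signs are checked for each choice of parities.\<close>
  have "defect b c x y u v - scale (ssign (a * c + (a + c) * (\<gamma> + b))) (defect b a u y x v)
     = scale (ssign (c * (\<gamma> + b))) (\<phi> (br x u) (br y v) - - scale (ssign (\<gamma> * (a + c) + \<gamma> * (b + d) + (a + c) * (b + d))) (\<phi> (br y v) (br x u)))"
    using bit_cases[of a] bit_cases[of b] bit_cases[of c] bit_cases[of d] bit_cases[of \<gamma>]
    unfolding defect_def E1 E2 K br_minus br_diff br_add_left br_add_right br_scale_left br_scale_right R
    by (elim disjE) (simp_all add: scale_ssign algebra_simps)
  with q show ?thesis by simp
qed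

lemma defect_antisym12:
  assumes "x \<in> G a" "y \<in> G b" "x \<in> W a" "y \<in> W b"
  shows "defect a c y x u v = - scale (ssign (\<gamma> * a + \<gamma> * b + a * b)) (defect b c x y u v)"
  using phi_skew[OF assms(2,1)] br_skew[OF assms(4,3)]
    bit_cases[of a] bit_cases[of b] bit_cases[of c] bit_cases[of \<gamma>]
  unfolding defect_def by (elim disjE) (simp_all add: scale_ssign br_minus)

text \<open>
  Up to Koszul signs the defect is symmetric under the transposition (13) and antisymmetric under
  (12), while the sixfold product (13)(12)(13)(12)(13)(12) is the identity.
\<close>

theorem phi_bracket:
  assumes char: "(2::'a) \<noteq> 0"
    and x: "x \<in> B a" and y: "y \<in> B b" and u: "u \<in> B c" and v: "v \<in> B d"
  shows "br (\<phi> x y) (br u v) = scale (ssign (\<gamma> * (b + c))) (br (br x y) (\<phi> u v))"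
proof -
  have G: "x \<in> G a" "y \<in> G b" "u \<in> G c" "v \<in> G d" using assms B_le_G by blast+
  then have W: "x \<in> W a" "y \<in> W b" "u \<in> W c" "v \<in> W d" using G_le_W by blast+
  \<comment> \<open>\<open>s1\<close> turns the triple (x, y, u) into (y, u, x), \<open>s2\<close>
    into (u, x, y), and \<open>s3\<close> restores it. Each round uses the antisymmetry once, so
    three rounds leave a factor -1.\<close>
  note s3 = defect_swap13[OF u x y v, unfolded defect_antisym12[OF G(1,2) W(1,2)]]
  note s2 = defect_swap13[OF y u x v, unfolded defect_antisym12[OF G(3,1) W(3,1)], unfolded s3]
  note s1 = defect_swap13[OF x y u v, unfolded defect_antisym12[OF G(2,3) W(2,3)], unfolded s2]
  have "defect b c x y u v = - defect b c x y u v"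
    using bit_cases[of a] bit_cases[of b] bit_cases[of c] bit_cases[of \<gamma>]
    by (subst s1, elim disjE) (simp_all add: scale_ssign)
  then have "scale 2 (defect b c x y u v) = 0"
    using scale_left_distrib[of 1 1 "defect b c x y u v"] by (simp add: eq_neg_iff_add_eq_0)
  then show ?thesis
    using char by (simp add: defect_def)
qed

end

section \<open>The operators \<open>D\<^sub>i\<close> and \<open>x\<^sub>a\<close> on \<open>\<Lambda>(m,n;t)\<close>\<close>

text \<open>The sign picked up when x_i moves to its sorted place from the front of x^u, or
  back.\<close>

definition isign :: "nat \<Rightarrow> nat set \<Rightarrow> 'a::ring_1" where
  "isign i u = (- 1) ^ card {j \<in> u. j < i}"

lemma isign_insert:
  assumes "j \<notin> u"
  shows "isign i (insert j u) = (if j < i then - isign i u else isign i u)"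
proof -
  have "{k \<in> insert j u. k < i} = (if j < i then insert j {k \<in> u. k < i} else {k \<in> u. k < i})"
    by auto
  then show ?thesis using assms by (simp add: isign_def)
qed

lemma isign_remove:
  assumes "j \<in> u"
  shows "(isign i (u - {j}) :: 'a::ring_1) = (if j < i then - isign i u else isign i u)"
  using isign_insert[of j "u - {j}" i, where 'a = 'a] assms
  by (simp add: insert_absorb split: if_splits)

lemma isign_square: "isign i u * (isign i u * c) = (c::'a::comm_ring_1)"
  by (simp add: isign_def flip: mult.assoc power_mult_distrib)

text \<open>
  \<open>pd m i\<close> and \<open>xop m a\<close> are \<open>D\<^sub>i\<close> and left multiplication by \<open>x\<^sub>a\<close> on coefficient functions. The index
  \<open>0\<close>, which lies outside \<open>Y\<close>, stands for the constant \<open>1\<close>, so that the fields \<open>D\<^sub>b\<close> and \<open>x\<^sub>a D\<^sub>b\<close>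
  need not be treated separately.
\<close>

definition pd :: "nat \<Rightarrow> nat \<Rightarrow> 'a::field lam \<Rightarrow> 'a lam" where
  "pd m i f = (\<lambda>(\<alpha>, u).
     if i \<in> Y0 m then f (\<alpha>(i := Suc (\<alpha> i)), u)
     else if i \<in> u then 0 else isign i u * f (\<alpha>, insert i u))"

definition xop :: "nat \<Rightarrow> nat \<Rightarrow> 'a::field lam \<Rightarrow> 'a lam" where
  "xop m a f = (\<lambda>(\<alpha>, u).
     if a = 0 then f (\<alpha>, u)
     else if a \<in> Y0 m then of_nat (\<alpha> a) * f (\<alpha>(a := \<alpha> a - 1), u)
     else if a \<in> u then isign a u * f (\<alpha>, u - {a}) else 0)"

definition gen1 :: "nat \<Rightarrow> nat \<Rightarrow> 'a::field lam" where
  "gen1 m a = (if a = 0 then bmono (0, {}) else gen m a)"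

text \<open>\<open>tau\<close> is 1 at every index outside \<open>Y0\<close>, hence at 0, whereas
  the constant 1 that index 0 stands for is even.\<close>

definition par :: "nat \<Rightarrow> nat \<Rightarrow> bit" where
  "par m a = (if a = 0 then 0 else tau m a)"

lemma zero_notin_Y: "0 \<notin> Y0 m" "0 \<notin> Y1 m n" "0 \<notin> Yall m n"
  by (auto simp: Y0_def Y1_def Yall_def)

lemma lscale_ssign: "lscale (ssign d) f = (if d = 0 then f else - f)"
  by (auto simp: ssign_def lscale_def fun_eq_iff)

lemma xop_linear: "xop m i (f + g) = xop m i f + xop m i g" "xop m i (lscale c f) = lscale c (xop m i f)"
  by (auto simp: xop_def lscale_def fun_eq_iff algebra_simps)

lemma pd_pd: "pd m i (pd m j f) = lscale (ssign (tau m i * tau m j)) (pd m j (pd m i f))"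
  by (auto simp: pd_def lscale_ssign tau_def fun_eq_iff isign_insert fun_upd_twist insert_commute)

lemma xop_xop: "xop m a (xop m c f) = lscale (ssign (par m a * par m c)) (xop m c (xop m a f))"
  by (cases "a = c")
    (auto simp: xop_def lscale_ssign tau_def par_def fun_eq_iff isign_remove fun_upd_twist
      insert_commute Diff_insert2[symmetric] mult_ac simp flip: Diff_insert)

text \<open>The Leibniz rule on x_a f. Together with \<open>pd_pd\<close> and \<open>xop_xop\<close>
  it allows affine fields to be composed without expanding products in the algebra.\<close>

lemma pd_xop:
  assumes "i \<noteq> 0"
  shows "pd m i (xop m a f) = (if i = a then f else 0)
    + lscale (ssign (tau m i * par m a)) (xop m a (pd m i f))"
proof -
  \<comment> \<open>Truncated subtraction is harmless: where \<open>\<alpha> i\<close> is 0, the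
    factor \<open>of_nat (\<alpha> i)\<close> vanishes.\<close>
  have S: "\<alpha>(i := Suc (\<alpha> i - Suc 0)) = \<alpha>" if "of_nat (\<alpha> i) \<noteq> (0::'a)" for \<alpha> :: "nat \<Rightarrow> nat"
    using that by (cases "\<alpha> i") (auto simp: fun_upd_idem)
  show ?thesis
    using assms
    by (cases "a = i")
      (auto simp: xop_def pd_def lscale_ssign tau_def par_def fun_eq_iff isign_remove isign_insert
        isign_square insert_absorb fun_upd_twist insert_Diff_if S algebra_simps)
qed

section \<open>Derivatives and products with generators in coordinates\<close>

locale special_superalgebra =
  fixes p m n :: nat and t :: "nat \<Rightarrow> nat" and T :: "'a::field itself"
  assumes char: "CHAR('a) = p" and p_gt: "p > 2" and m_ge: "m \<ge> 2" and n_ge: "n \<ge> 2"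
    and t_pos: "i \<in> Y0 m \<Longrightarrow> t i > 0"
begin

abbreviation "I \<equiv> basis_idx p m n t"
abbreviation "Y \<equiv> Yall m n"
abbreviation "Lm \<equiv> Lam p m n t :: 'a lam set"
abbreviation "Lh \<equiv> Lam_hom p m n t :: bit \<Rightarrow> 'a lam set"
abbreviation "D \<equiv> Dop p m n t :: nat \<Rightarrow> 'a lam \<Rightarrow> 'a lam"
abbreviation "mult \<equiv> lmult p m n t :: 'a lam \<Rightarrow> 'a lam \<Rightarrow> 'a lam"
abbreviation "g \<equiv> gen1 m :: nat \<Rightarrow> 'a lam"

lemma pow_ge: "i \<in> Y0 m \<Longrightarrow> p ^ t i \<ge> 3"
  using p_gt t_pos[of i] power_increasing[of 1 "t i" p] by simp

lemma of_nat_pow: "i \<in> Y0 m \<Longrightarrow> of_nat (p ^ t i) = (0::'a)"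
  using t_pos[of i] of_nat_CHAR[where 'a = 'a] by (simp add: char)

lemma finite_I: "finite I"
proof -
  define N where "N = Max (insert 0 ((\<lambda>i. p ^ t i - 1) ` Y0 m))"
  have N: "i \<in> Y0 m \<Longrightarrow> p ^ t i - 1 \<le> N" for i
    unfolding N_def by (rule Max_ge) (auto simp: Y0_def)
  have "finite {f. \<forall>x. (x \<in> Y0 m \<longrightarrow> f x \<in> {..N}) \<and> (x \<notin> Y0 m \<longrightarrow> f x = 0)}"
    by (rule finite_set_of_finite_funs) (auto simp: Y0_def)
  then have "finite (multi_idx p m t)"
    by (rule finite_subset[rotated]) (use N in \<open>auto simp: multi_idx_def intro: order_trans\<close>)
  then show ?thesis
    by (simp add: basis_idx_def Y1_def)
qed

lemma sum_lam_apply: "(\<Sum>x\<in>A. h x) k = (\<Sum>x\<in>A. h x k)" for h :: "'b \<Rightarrow> 'c \<Rightarrow> 'd::comm_monoid_add"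
  by (induction A rule: infinite_finite_induct) auto

lemma Dop_apply: "D i f k = (\<Sum>l\<in>I. f l * D_bmono m i l k)"
  by (simp add: Dop_def sum_lam_apply lscale_def)

lemma lmult_apply: "mult f h k = (\<Sum>l\<in>I. \<Sum>r\<in>I. f l * h r * bmono_mult p m t l r k)"
  by (simp add: lmult_def sum_lam_apply lscale_def)

lemma Dop_linear: "D i (f + h) = D i f + D i h" "D i (lscale c f) = lscale c (D i f)"
  by (auto simp: Dop_apply fun_eq_iff lscale_def sum.distrib sum_distrib_left algebra_simps)

lemma lmult_linear:
  "mult (f + f') h = mult f h + mult f' h" "mult (lscale c f) h = lscale c (mult f h)"
  "mult f (h + h') = mult f h + mult f h'" "mult f (lscale c h) = lscale c (mult f h)"
  by (auto simp: lmult_apply fun_eq_iff lscale_def sum.distrib sum_distrib_left algebra_simps)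

text \<open>At most one basis element contributes to a given coefficient; if its index lies outside
  \<open>I\<close>, then \<open>f\<close> is zero there.\<close>

lemma Dop_eq_pd:
  assumes f: "f \<in> Lm" and i: "i \<in> Y"
  shows "D i f = pd m i f"
proof
  fix k :: idx
  obtain \<alpha> u where k: "k = (\<alpha>, u)" by (cases k)
  show "D i f k = pd m i f k"
  proof (cases "i \<in> Y0 m")
    case True
    have "D i f k = (\<Sum>l\<in>I. if l = (\<alpha>(i := Suc (\<alpha> i)), u) then f l else 0)"
      unfolding Dop_apply
      by (rule sum.cong) (use True in \<open>auto simp: D_bmono_def bmono_def k split: if_splits\<close>)
    then show ?thesis
      using True f by (auto simp: finite_I sum.delta pd_def k Lam_def)
  next
    case False
    have "D i f k = (\<Sum>l\<in>I. if l = (\<alpha>, insert i u) then (if i \<in> u then 0 else isign i u * f l) else 0)"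
      unfolding Dop_apply
    proof (rule sum.cong)
      fix l assume "l \<in> I"
      obtain \<beta> v where l: "l = (\<beta>, v)" by (cases l)
      have *: "{j. (j = i \<or> j \<in> u) \<and> j < i} = {j \<in> u. j < i}" by auto
      show "f l * D_bmono m i l k = (if l = (\<alpha>, insert i u) then (if i \<in> u then 0 else isign i u * f l) else 0)"
        using False by (auto simp: l k D_bmono_def bmono_def lscale_def isign_def *)
    qed simp
    then show ?thesis
      using False f by (auto simp: finite_I sum.delta pd_def k Lam_def)
  qed
qed

lemma gen1_eq:
  assumes "a \<in> insert 0 Y"
  shows "g a = bmono (if a \<in> Y0 m then eps a else 0, if a = 0 \<or> a \<in> Y0 m then {} else {a})"
  using assms by (auto simp: gen1_def gen_def zero_notin_Y)

lemma gen1_idx: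
  assumes "a \<in> insert 0 Y"
  shows "(if a \<in> Y0 m then eps a else 0, if a = 0 \<or> a \<in> Y0 m then {} else {a}) \<in> I"
  using assms pow_ge[of a] by (auto simp: basis_idx_def multi_idx_def eps_def Yall_def)

lemma lmult_bmono:
  assumes "l \<in> I"
  shows "mult (bmono l) f k = (\<Sum>r\<in>I. f r * bmono_mult p m t l r k)"
proof -
  have "mult (bmono l) f k = (\<Sum>l'\<in>I. if l' = l then \<Sum>r\<in>I. f r * bmono_mult p m t l r k else 0)"
    unfolding lmult_apply by (rule sum.cong) (auto simp: bmono_def)
  then show ?thesis using assms by (simp add: finite_I)
qed

lemma lmult_gen1:
  assumes f: "f \<in> Lm" and a: "a \<in> insert 0 Y"
  shows "mult (g a) f = xop m a f"
proof
  fix k :: idx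
  obtain \<alpha> u where k: "k = (\<alpha>, u)" by (cases k)
  show "mult (g a) f k = xop m a f k"
  proof -
    consider "a = 0" | "a \<in> Y0 m" "a \<noteq> 0" | "a \<notin> Y0 m" "a \<noteq> 0"
      by blast
    then have "mult (g a) f k = (\<Sum>r\<in>I. if r = (if a \<in> Y0 m then \<alpha>(a := \<alpha> a - 1) else \<alpha>, if a = 0 \<or> a \<in> Y0 m then u else u - {a})
        then (if a = 0 then 1 else if a \<in> Y0 m then of_nat (\<alpha> a) else if a \<in> u then isign a u else 0) * f r else 0)"
    proof cases
      case 1
      show ?thesis
        unfolding gen1_eq[OF a] lmult_bmono[OF gen1_idx[OF a]]
        by (rule sum.cong)
          (auto simp: 1 zero_notin_Y k bmono_mult_def grass_sign_def bmono_def lscale_def basis_idx_def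
            split: if_splits)
    next
      case 2
      have prod: "(\<Prod>i\<in>Y0 m. (eps a i + \<beta> i) choose eps a i) = Suc (\<beta> a)" for \<beta>
      proof -
        have "(\<Prod>i\<in>Y0 m. (eps a i + \<beta> i) choose eps a i) = (\<Prod>i\<in>Y0 m. if i = a then Suc (\<beta> a) else 1)"
          by (rule prod.cong) (auto simp: eps_def)
        then show ?thesis using 2 by (simp add: Y0_def)
      qed
      show ?thesis
        unfolding gen1_eq[OF a] lmult_bmono[OF gen1_idx[OF a]]
      proof (rule sum.cong)
        fix r assume "r \<in> I"
        obtain \<beta> v where r: "r = (\<beta>, v)" by (cases r)
        have \<beta>: "\<beta> \<in> multi_idx p m t" using \<open>r \<in> I\<close> by (simp add: r basis_idx_def)
        have up: "eps a + \<beta> = \<beta>(a := Suc (\<beta> a))" by (auto simp: eps_def fun_eq_iff)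
        \<comment> \<open>A product beyond the truncation carries the binomial factor
          \<open>\<beta> a\<close> + 1 = p ^ t a, which is zero in the field. This is why
          \<open>xop\<close> contains no truncation.\<close>
        have z: "of_nat (Suc (\<beta> a)) = (0::'a)" if "eps a + \<beta> \<notin> multi_idx p m t"
        proof -
          have "Suc (\<beta> a) > p ^ t a - 1"
            using that \<beta> 2 unfolding up by (auto simp: multi_idx_def split: if_splits)
          moreover have "\<beta> a \<le> p ^ t a - 1" using \<beta> 2 by (auto simp: multi_idx_def)
          ultimately have "Suc (\<beta> a) = p ^ t a" using pow_ge[OF 2(1)] by linarith
          then show ?thesis using of_nat_pow[OF 2(1)] by simp
        qed
        show "f r * bmono_mult p m t (if a \<in> Y0 m then eps a else 0, if a = 0 \<or> a \<in> Y0 m then {} else {a}) r k =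
          (if r = (if a \<in> Y0 m then \<alpha>(a := \<alpha> a - 1) else \<alpha>, if a = 0 \<or> a \<in> Y0 m then u else u - {a})
           then (if a = 0 then 1 else if a \<in> Y0 m then of_nat (\<alpha> a) else if a \<in> u then isign a u else 0) * f r else 0)"
        proof (cases "\<alpha> = \<beta>(a := Suc (\<beta> a))")
          case True
          then show ?thesis
            using 2 z unfolding up
            by (auto simp: r k bmono_mult_def prod grass_sign_def bmono_def lscale_def up)
        next
          case False
          then have "\<alpha> a = 0 \<or> \<beta> \<noteq> \<alpha>(a := \<alpha> a - 1)" by auto
          moreover have "\<alpha> \<noteq> eps a + \<beta>" using False by (simp add: up)
          ultimately show ?thesis
            using 2 by (auto simp: r k bmono_mult_def bmono_def lscale_def)
        qed
      qed simp
    next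
      case 3
      have gs: "grass_sign {a} v = isign a v" for v
      proof -
        have "{(i, j). i \<in> {a} \<and> j \<in> v \<and> j < i} = Pair a ` {j \<in> v. j < a}" by auto
        then show ?thesis by (simp add: grass_sign_def isign_def card_image inj_on_def)
      qed
      show ?thesis
        unfolding gen1_eq[OF a] lmult_bmono[OF gen1_idx[OF a]]
        by (rule sum.cong)
          (use 3 in \<open>auto simp: k bmono_mult_def gs bmono_def lscale_def basis_idx_def isign_remove isign_insert
            split: if_splits\<close>)
    qed
    then show ?thesis
      using f by (auto simp: finite_I sum.delta xop_def k Lam_def zero_notin_Y)
  qed
qed

lemma lmult_one:
  assumes f: "f \<in> Lm"
  shows "mult f (g 0) = f"
proof
  fix k :: idx
  have g0: "g 0 = bmono (0, {})" by (simp add: gen1_def)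
  have i0: "(0, {}) \<in> I" by (simp add: basis_idx_def multi_idx_def)
  have "mult f (g 0) k = (\<Sum>l\<in>I. \<Sum>r\<in>I. if r = (0, {}) then f l * bmono_mult p m t l r k else 0)"
    unfolding lmult_apply g0 by (intro sum.cong) (auto simp: bmono_def)
  also have "\<dots> = (\<Sum>l\<in>I. f l * bmono_mult p m t l (0, {}) k)"
    by (simp add: finite_I i0)
  also have "\<dots> = (\<Sum>l\<in>I. if l = k then f l else 0)"
    by (rule sum.cong)
      (auto simp: bmono_mult_def grass_sign_def bmono_def lscale_def basis_idx_def)
  also have "\<dots> = f k" using f by (cases k) (auto simp: finite_I Lam_def)
  finally show "mult f (g 0) k = f k" .
qed

end

section \<open>The bracket of \<open>W(m,n;t)\<close>\<close>

lemma bit_add_self: "(d::bit) + d = 0" "(d::bit) + (d + e) = e" "(e + d) + d = (e::bit)"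
  using bit_cases[of d] by (auto simp: add.assoc)

context special_superalgebra
begin

abbreviation "Wh \<equiv> W_hom p m n t :: bit \<Rightarrow> 'a sder set"
abbreviation "br \<equiv> bracket p m n t :: 'a sder \<Rightarrow> 'a sder \<Rightarrow> 'a sder"
abbreviation "s d \<equiv> (ssign d :: 'a)"

text \<open>The action of a vector field on functions, through which brackets are computed
  coefficient by coefficient.\<close>

definition op :: "'a sder \<Rightarrow> 'a lam \<Rightarrow> 'a lam" where
  "op X f = (\<Sum>i\<in>Y. mult (X i) (D i f))"

lemma lmult_zero: "mult 0 f = 0" "mult f 0 = 0"
  by (auto simp: lmult_apply fun_eq_iff)

lemma Dop_zero: "D i 0 = 0"
  by (auto simp: Dop_apply fun_eq_iff)

lemma lscale_simps: "lscale c (f + h) = lscale c f + lscale c h" "lscale c (0::'a lam) = 0"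
  "lscale c (lscale d f) = lscale (c * d) f" "lscale 1 f = f" "lscale c (- f) = - lscale c f"
  "lscale c (f - h) = lscale c f - lscale c h" for f h :: "'a lam"
  by (auto simp: lscale_def fun_eq_iff algebra_simps)

lemma lscale_sum: "lscale c (\<Sum>x\<in>A. h x) = (\<Sum>x\<in>A. lscale c (h x))" for h :: "'b \<Rightarrow> 'a lam"
  by (auto simp: lscale_def fun_eq_iff sum_lam_apply sum_distrib_left)

lemma op_linear: "op (X + Z) f = op X f + op Z f" "op (wscale c X) f = lscale c (op X f)"
  "op X (f + h) = op X f + op X h" "op X (lscale c f) = lscale c (op X f)"
  by (simp_all add: op_def wscale_def lmult_linear Dop_linear sum.distrib lscale_sum)

lemma op_zero: "op 0 f = 0" "op X 0 = 0"
  by (simp_all add: op_def Dop_zero lmult_zero)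

lemma op_minus: "op (- X) f = - op X f" "op X (- f) = - op X f"
  using op_linear(1)[of X "- X" f] op_linear(3)[of X f "- f"]
  by (simp_all add: op_zero eq_neg_iff_add_eq_0 add.commute)

lemma op_diff: "op (X - Z) f = op X f - op Z f" "op X (f - h) = op X f - op X h"
  using op_linear(1)[of X "- Z" f] op_linear(3)[of X f "- h"] by (simp_all add: op_minus)

lemma Lh_Lm: "f \<in> Lh d \<Longrightarrow> f \<in> Lm"
  by (simp add: Lam_hom_def)

lemma Lh_iff: "f \<in> Lh d \<longleftrightarrow> (\<forall>k. f k \<noteq> 0 \<longrightarrow> k \<in> I \<and> idx_parity k = d)"
  by (auto simp: Lam_hom_def Lam_def)

lemma Lh_D: "f \<in> Lh d \<Longrightarrow> f k \<noteq> 0 \<Longrightarrow> k \<in> I \<and> idx_parity k = d"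
  unfolding Lh_iff by blast

lemma Lm_linear: "f \<in> Lm \<Longrightarrow> h \<in> Lm \<Longrightarrow> f + h \<in> Lm" "f \<in> Lm \<Longrightarrow> lscale c f \<in> Lm" "0 \<in> Lm"
  by (auto simp: Lam_def lscale_def)

lemma Lh_linear: "f \<in> Lh d \<Longrightarrow> h \<in> Lh d \<Longrightarrow> f + h \<in> Lh d" "f \<in> Lh d \<Longrightarrow> h \<in> Lh d \<Longrightarrow> f - h \<in> Lh d"
  "f \<in> Lh d \<Longrightarrow> lscale c f \<in> Lh d" "0 \<in> Lh d"
proof -
  show "f + h \<in> Lh d" "f - h \<in> Lh d" if "f \<in> Lh d" "h \<in> Lh d"
    unfolding Lh_iff
  proof (safe del: conjI)
    fix k
    show "k \<in> I \<and> idx_parity k = d" if "(f + h) k \<noteq> 0"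
      using that \<open>f \<in> Lh d\<close> \<open>h \<in> Lh d\<close> by (cases "f k = 0") (auto dest: Lh_D)
    show "k \<in> I \<and> idx_parity k = d" if "(f - h) k \<noteq> 0"
      using that \<open>f \<in> Lh d\<close> \<open>h \<in> Lh d\<close> by (cases "f k = 0") (auto dest: Lh_D)
  qed
qed (auto simp: Lh_iff lscale_def)

lemma Lh_sum: "(\<And>x. x \<in> A \<Longrightarrow> h x \<in> Lh d) \<Longrightarrow> (\<Sum>x\<in>A. h x) \<in> Lh d"
  by (induction A rule: infinite_finite_induct) (auto simp: Lh_linear)

lemma finite_Y: "finite Y"
  by (simp add: Yall_def Y0_def Y1_def)

lemma I_finite: "(\<alpha>, u) \<in> I \<Longrightarrow> finite u"
  by (auto simp: basis_idx_def Y1_def intro: finite_subset)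

lemma lmult_nonzeroE:
  assumes "mult f h k \<noteq> 0"
  obtains \<alpha> u \<beta> v where "(\<alpha>, u) \<in> I" "(\<beta>, v) \<in> I" "f (\<alpha>, u) \<noteq> 0" "h (\<beta>, v) \<noteq> 0"
    "u \<inter> v = {}" "k = (\<alpha> + \<beta>, u \<union> v)" "k \<in> I"
proof -
  obtain l where "l \<in> I" "(\<Sum>r\<in>I. f l * h r * bmono_mult p m t l r k) \<noteq> 0"
    using assms unfolding lmult_apply by (meson sum.neutral)
  then obtain r where lr: "l \<in> I" "r \<in> I" "f l * h r * bmono_mult p m t l r k \<noteq> 0"
    by (meson sum.neutral)
  obtain \<alpha> u \<beta> v where e: "l = (\<alpha>, u)" "r = (\<beta>, v)" by (cases l; cases r)
  have "\<alpha> + \<beta> \<in> multi_idx p m t" "u \<inter> v = {}" "k = (\<alpha> + \<beta>, u \<union> v)"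
    using lr(3) by (auto simp: e bmono_mult_def lscale_def bmono_def split: if_splits)
  with lr show thesis
    by (intro that[of \<alpha> u \<beta> v]) (auto simp: e basis_idx_def)
qed

lemma lmult_Lm: "mult f h \<in> Lm"
  unfolding Lam_def by (auto elim: lmult_nonzeroE)

lemma lmult_hom:
  assumes "f \<in> Lh c" "h \<in> Lh d"
  shows "mult f h \<in> Lh (c + d)"
  unfolding Lh_iff
proof (intro allI impI)
  fix k assume "mult f h k \<noteq> 0"
  then obtain \<alpha> u \<beta> v where *: "(\<alpha>, u) \<in> I" "(\<beta>, v) \<in> I" "f (\<alpha>, u) \<noteq> 0" "h (\<beta>, v) \<noteq> 0"
    "u \<inter> v = {}" "k = (\<alpha> + \<beta>, u \<union> v)" "k \<in> I" by (rule lmult_nonzeroE)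
  then have "idx_parity (\<alpha>, u) = c" "idx_parity (\<beta>, v) = d" using assms by (auto dest: Lh_D)
  then show "k \<in> I \<and> idx_parity k = c + d"
    using I_finite * by (auto simp: idx_parity_def card_Un_disjoint)
qed

lemma Lm_pd:
  assumes f: "f \<in> Lm" and "i \<in> Y"
  shows "pd m i f \<in> Lm"
  unfolding Lam_def
proof clarify
  fix \<alpha> u assume *: "(\<alpha>, u) \<notin> I"
  then have "(\<alpha>(i := Suc (\<alpha> i)), u) \<notin> I" if "i \<in> Y0 m"
    using that by (auto simp: basis_idx_def multi_idx_def split: if_splits)
      (metis Suc_leD)
  moreover have "(\<alpha>, insert i u) \<notin> I"
    using * by (auto simp: basis_idx_def)
  ultimately show "pd m i f (\<alpha>, u) = 0"
    using f by (auto simp: pd_def Lam_def)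
qed

lemma Dop_hom:
  assumes f: "f \<in> Lh d" and i: "i \<in> Y"
  shows "D i f \<in> Lh (d + tau m i)"
  unfolding Lh_iff Dop_eq_pd[OF Lh_Lm[OF f] i]
proof (intro allI impI)
  fix k assume k: "pd m i f k \<noteq> 0"
  obtain \<alpha> u where ku: "k = (\<alpha>, u)" by (cases k)
  have 1: "k \<in> I" using k Lm_pd[OF Lh_Lm[OF f] i] unfolding Lam_def by blast
  have "idx_parity k = d + tau m i"
  proof (cases "i \<in> Y0 m")
    case True
    then show ?thesis using k Lh_D[OF f] by (auto simp: pd_def ku tau_def idx_parity_def)
  next
    case False
    then have "idx_parity (\<alpha>, insert i u) = d" "i \<notin> u"
      using k Lh_D[OF f] by (auto simp: pd_def ku split: if_splits)
    then show ?thesis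
      using 1 I_finite False bit_add_self[of 1] by (auto simp: ku idx_parity_def tau_def add_ac)
  qed
  with 1 show "k \<in> I \<and> idx_parity k = d + tau m i" ..
qed

lemma op_hom:
  assumes X: "X \<in> Wh c" and f: "f \<in> Lh d"
  shows "op X f \<in> Lh (c + d)"
  unfolding op_def
proof (rule Lh_sum)
  fix i assume i: "i \<in> Y"
  then have "X i \<in> Lh (c + tau m i)" using X by (simp add: W_hom_def)
  from lmult_hom[OF this Dop_hom[OF f i]] show "mult (X i) (D i f) \<in> Lh (c + d)"
    using bit_cases[of "tau m i"] by (auto simp: bit_add_self add_ac)
qed

lemma hpart_Lh: "f \<in> Lh d \<Longrightarrow> hpart a f = (if a = d then f else 0)"
  by (auto simp: hpart_def Lh_iff fun_eq_iff)

text \<open>Each component of a homogeneous field has one parity, so a single term of the parity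
  sums survives. There \<open>tau\<close> is added twice to each degree and cancels, which leaves
  the sign of \<open>c * d\<close>.\<close>

lemma bracket_eq:
  assumes X: "X \<in> Wh c" and Z: "Z \<in> Wh d"
  shows "br X Z = (\<lambda>j. op X (Z j) - lscale (s (c * d)) (op Z (X j)))"
proof -
  let ?T = "\<lambda>i j. fD (mult (X i) (D i (Z j))) j - wscale (s (c * d)) (fD (mult (Z j) (D j (X i))) i)"
  have out: "X j = 0" "Z j = 0" if "j \<notin> Y" for j
    using X Z that by (auto simp: W_hom_def W_alg_def)
  have z: "term_bracket p m n t a 0 i b f j = 0" "term_bracket p m n t a f i b 0 j = 0"
    for a b i j and f :: "'a lam"
    by (auto simp: term_bracket_def fD_def wscale_def Dop_zero lmult_zero lscale_simps fun_eq_iff)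
  have "(\<Sum>a\<in>{0, 1}. \<Sum>b\<in>{0, 1}. term_bracket p m n t a (hpart a (X i)) i b (hpart b (Z j)) j) = ?T i j"
    if ij: "i \<in> Y" "j \<in> Y" for i j
  proof -
    have h: "X i \<in> Lh (c + tau m i)" "Z j \<in> Lh (d + tau m j)"
      using X Z ij by (auto simp: W_hom_def)
    have "(\<Sum>a\<in>{0, 1}. \<Sum>b\<in>{0, 1}. term_bracket p m n t a (hpart a (X i)) i b (hpart b (Z j)) j)
       = term_bracket p m n t (c + tau m i) (X i) i (d + tau m j) (Z j) j"
      unfolding hpart_Lh[OF h(1)] hpart_Lh[OF h(2)]
      using bit_cases[of "c + tau m i"] bit_cases[of "d + tau m j"] by (auto simp: z)
    also have "\<dots> = ?T i j"
      by (simp add: term_bracket_def bit_add_self)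
    finally show ?thesis .
  qed
  then have "br X Z = (\<Sum>i\<in>Y. \<Sum>j\<in>Y. ?T i j)"
    by (simp add: bracket_def)
  also have "\<dots> = (\<lambda>j. op X (Z j) - lscale (s (c * d)) (op Z (X j)))"
  proof
    fix l
    have 1: "(\<Sum>i\<in>Y. \<Sum>j\<in>Y. fD (mult (X i) (D i (Z j))) j l) = op X (Z l)"
    proof -
      have "(\<Sum>j\<in>Y. fD (mult (X i) (D i (Z j))) j l) = mult (X i) (D i (Z l))" for i
        using out(2)[of l] by (simp add: fD_def finite_Y Dop_zero lmult_zero if_distrib)
      then show ?thesis by (simp add: op_def)
    qed
    have 2: "(\<Sum>i\<in>Y. \<Sum>j\<in>Y. wscale (s (c * d)) (fD (mult (Z j) (D j (X i))) i) l) = lscale (s (c * d)) (op Z (X l))"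
    proof -
      have "(\<Sum>i\<in>Y. wscale (s (c * d)) (fD (mult (Z j) (D j (X i))) i) l) = lscale (s (c * d)) (mult (Z j) (D j (X l)))" for j
      proof -
        have "(\<Sum>i\<in>Y. wscale (s (c * d)) (fD (mult (Z j) (D j (X i))) i) l)
          = (\<Sum>i\<in>Y. if i = l then lscale (s (c * d)) (mult (Z j) (D j (X l))) else 0)"
          by (rule sum.cong) (auto simp: wscale_def fD_def lscale_simps)
        then show ?thesis
          using out(1)[of l] by (simp add: finite_Y Dop_zero lmult_zero lscale_simps)
      qed
      then show ?thesis
        by (subst sum.swap) (simp add: op_def lscale_sum)
    qed
    show "(\<Sum>i\<in>Y. \<Sum>j\<in>Y. ?T i j) l = op X (Z l) - lscale (s (c * d)) (op Z (X l))"
      using 1 2 by (simp add: sum_lam_apply sum_subtractf)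
  qed
  finally show ?thesis .
qed

lemma bracket_hom:
  assumes X: "X \<in> Wh c" and Z: "Z \<in> Wh d"
  shows "br X Z \<in> Wh (c + d)"
proof -
  have h: "X i \<in> Lh (c + tau m i)" "Z i \<in> Lh (d + tau m i)" for i
    using X Z by (cases "i \<in> Y"; auto simp: W_hom_def W_alg_def Lh_linear)+
  have "br X Z i \<in> Lh (c + d + tau m i)" for i
    unfolding bracket_eq[OF X Z]
    using op_hom[OF X h(2)[of i]] op_hom[OF Z h(1)[of i]]
    by (auto intro!: Lh_linear simp: add_ac)
  moreover have "br X Z i = 0" if "i \<notin> Y" for i
    using X Z that unfolding bracket_eq[OF X Z]
    by (auto simp: W_hom_def W_alg_def op_zero lscale_simps)
  ultimately show ?thesis
    by (auto simp: W_hom_def W_alg_def intro: Lh_Lm)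
qed

lemma bracket_skew:
  assumes "X \<in> Wh c" "Z \<in> Wh d"
  shows "br X Z = - wscale (s (c * d)) (br Z X)"
  unfolding bracket_eq[OF assms] bracket_eq[OF assms(2,1)]
  using bit_cases[of c] bit_cases[of d] by (auto simp: wscale_def lscale_ssign fun_eq_iff)

lemma bracket_linear:
  "br (X + X') Z = br X Z + br X' Z" "br X (Z + Z') = br X Z + br X Z'"
  "br (wscale c X) Z = wscale c (br X Z)" "br X (wscale c Z) = wscale c (br X Z)"
proof -
  have hp: "hpart a (f + h) = hpart a f + hpart a h" "hpart a (lscale c f) = lscale c (hpart a f)"
    for a and f h :: "'a lam"
    by (auto simp: hpart_def lscale_def)
  have fd: "fD (f + h) i = fD f i + fD h i" "fD (lscale c f) i = wscale c (fD f i)" for f h :: "'a lam" and i c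
    by (auto simp: fD_def wscale_def lscale_simps fun_eq_iff)
  have tb: "term_bracket p m n t a (f + f') i b h j = term_bracket p m n t a f i b h j + term_bracket p m n t a f' i b h j"
    "term_bracket p m n t a h i b (f + f') j = term_bracket p m n t a h i b f j + term_bracket p m n t a h i b f' j"
    "term_bracket p m n t a (lscale c f) i b h j = wscale c (term_bracket p m n t a f i b h j)"
    "term_bracket p m n t a h i b (lscale c f) j = wscale c (term_bracket p m n t a h i b f j)"
    for a b i j and f f' h :: "'a lam"
    by (simp_all only: term_bracket_def lmult_linear Dop_linear fd sder.scale_right_distrib
        sder.scale_right_diff_distrib sder.scale_left_commute[of _ c] add_diff_add)
  show "br (X + X') Z = br X Z + br X' Z" "br X (Z + Z') = br X Z + br X Z'"
    by (simp_all only: bracket_def hp tb sum.distrib plus_fun_apply)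
  show "br (wscale c X) Z = wscale c (br X Z)" "br X (wscale c Z) = wscale c (br X Z)"
    by (simp_all only: bracket_def sder.scale_sum_right wscale_def[of c X] wscale_def[of c Z] hp tb)
qed

section \<open>Affine vector fields and their Jacobi identity\<close>

abbreviation "Sa \<equiv> S_alg p m n t :: 'a sder set"
abbreviation "Sh \<equiv> S_hom p m n t :: bit \<Rightarrow> 'a sder set"
abbreviation "Y' \<equiv> insert 0 Y"
abbreviation "deg a b \<equiv> par m a + tau m b"

definition xD :: "nat \<Rightarrow> nat \<Rightarrow> 'a sder" where
  "xD a b = fD (g a) b"

lemma gen1_Lh: "a \<in> Y' \<Longrightarrow> g a \<in> Lh (par m a)"
  using gen1_idx[of a] zero_notin_Y(1)[of m]
  by (auto simp: gen1_eq Lh_iff bmono_def par_def tau_def idx_parity_def split: if_splits)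

lemma xop_gen1_0: "a \<in> Y' \<Longrightarrow> xop m a (g 0) = g a"
  using lmult_gen1[of "g 0" a] lmult_one[of "g a"] gen1_Lh[THEN Lh_Lm] by auto

lemma xop_zero: "xop m a 0 = 0"
  by (auto simp: xop_def fun_eq_iff)

lemma pd_gen1:
  assumes "a \<in> Y'" "b \<in> Y"
  shows "pd m b (g a) = (if b = a then g 0 else 0)"
proof -
  have "pd m b (g 0) = 0"
    by (auto simp: pd_def gen1_def bmono_def fun_eq_iff)
  moreover have "b \<noteq> 0" using assms zero_notin_Y by metis
  ultimately show ?thesis
    using pd_xop[of b m a "g 0"] assms by (auto simp: xop_gen1_0 xop_zero lscale_simps)
qed

lemma xD_Wh: "a \<in> Y' \<Longrightarrow> b \<in> Y \<Longrightarrow> xD a b \<in> Wh (deg a b)"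
  using gen1_Lh[of a]
  by (auto simp: xD_def W_hom_def W_alg_def fD_def bit_add_self Lh_linear Lm_linear intro: Lh_Lm)

lemma op_xD:
  assumes "f \<in> Lm" "a \<in> Y'" "b \<in> Y"
  shows "op (xD a b) f = xop m a (pd m b f)"
proof -
  have "op (xD a b) f = (\<Sum>i\<in>Y. if i = b then mult (g a) (D b f) else 0)"
    unfolding op_def by (rule sum.cong) (auto simp: xD_def fD_def lmult_zero)
  then show ?thesis
    using assms Lm_pd[of f b] by (simp add: finite_Y Dop_eq_pd lmult_gen1)
qed

lemma Wh_Lh: "X \<in> Wh d \<Longrightarrow> X i \<in> Lh (d + tau m i)"
  by (cases "i \<in> Y") (auto simp: W_hom_def W_alg_def Lh_linear)

lemma Wh_0: "X \<in> Wh d \<Longrightarrow> i \<notin> Y \<Longrightarrow> X i = 0"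
  by (auto simp: W_hom_def W_alg_def)

text \<open>A field is recovered from its values on generators. For \<open>a = 0\<close> both sides
  vanish, as constants are killed and there is no coefficient outside \<open>Y\<close>.\<close>

lemma op_gen1:
  assumes X: "X \<in> Wh d" and a: "a \<in> Y'"
  shows "op X (g a) = X a"
proof -
  have "op X (g a) = (\<Sum>i\<in>Y. if i = a then X a else 0)"
    unfolding op_def
    by (rule sum.cong)
      (use a gen1_Lh[OF a, THEN Lh_Lm] Wh_Lh[OF X, THEN Lh_Lm] in \<open>auto simp: Dop_eq_pd pd_gen1 lmult_one lmult_zero\<close>)
  then show ?thesis
    using Wh_0[OF X, of a] by (simp add: finite_Y)
qed

text \<open>These are the relations of the matrix units of gl(m|n), with the translations D_b added
  at index 0.\<close>

lemma bracket_xD: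
  assumes "a \<in> Y'" "b \<in> Y" "c \<in> Y'" "d \<in> Y"
  shows "br (xD a b) (xD c d) = (if b = c then xD a d else 0)
    - wscale (s (deg a b * deg c d)) (if d = a then xD c b else 0)"
proof
  fix j
  have L: "xD a b i \<in> Lm" "xD c d i \<in> Lm" for i
    using xD_Wh assms Wh_Lh Lh_Lm by blast+
  have "xD x y j = (if j = y then g x else 0)" for x y by (simp add: xD_def fD_def)
  moreover have "op (xD a b) (g c) = (if b = c then g a else 0)"
    "op (xD c d) (g a) = (if d = a then g c else 0)"
    using assms gen1_Lh[THEN Lh_Lm] by (simp_all add: op_xD pd_gen1 xop_gen1_0 xop_zero)
  ultimately show "br (xD a b) (xD c d) j = ((if b = c then xD a d else 0)
    - wscale (s (deg a b * deg c d)) (if d = a then xD c b else 0)) j"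
    unfolding bracket_eq[OF xD_Wh[OF assms(1,2)] xD_Wh[OF assms(3,4)]]
    by (auto simp: op_zero wscale_def lscale_simps)
qed

text \<open>Normal ordering: both compositions contain the same second-order term \<open>?T\<close>,
  which cancels with its signs, and the first-order terms form the bracket.\<close>

lemma op_bracket_xD:
  assumes "a \<in> Y'" "b \<in> Y" "c \<in> Y'" "d \<in> Y" "f \<in> Lm"
  shows "op (br (xD a b) (xD c d)) f
    = op (xD a b) (op (xD c d) f) - lscale (s (deg a b * deg c d)) (op (xD c d) (op (xD a b) f))"
proof -
  have nz: "b \<noteq> 0" "d \<noteq> 0" using assms zero_notin_Y by metis+
  have L: "xop m x (pd m y f) \<in> Lm" if "x \<in> Y'" "y \<in> Y" for x y
    using that lmult_gen1[OF Lm_pd[OF assms(5)], of y x] lmult_Lm by metis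
  have tb: "par m b = tau m b" "par m d = tau m d" using nz by (auto simp: par_def)
  let ?T = "xop m a (xop m c (pd m b (pd m d f)))"
  have 1: "op (xD a b) (op (xD c d) f)
    = (if b = c then xop m a (pd m d f) else 0) + lscale (s (tau m b * par m c)) ?T"
    using assms L nz by (auto simp: op_xD pd_xop[of b m c] xop_linear xop_zero)
  have 2: "op (xD c d) (op (xD a b) f) = (if d = a then xop m c (pd m b f) else 0)
     + lscale (s (tau m d * par m a) * (s (par m c * par m a) * s (tau m d * tau m b))) ?T"
    using assms L nz
    by (auto simp: op_xD pd_xop[of d m a] xop_linear xop_zero xop_xop[of m c a] pd_pd[of m d b] lscale_simps mult_ac)
  have 3: "op (br (xD a b) (xD c d)) f = (if b = c then xop m a (pd m d f) else 0)
    - lscale (s (deg a b * deg c d)) (if d = a then xop m c (pd m b f) else 0)"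
    unfolding bracket_xD[OF assms(1-4)] op_diff op_linear
    using assms by (auto simp: op_xD op_zero)
  have "s (tau m b * par m c) = s (deg a b * deg c d) * (s (tau m d * par m a) * (s (par m c * par m a) * s (tau m d * tau m b)))"
    using bit_cases[of "par m a"] bit_cases[of "tau m b"] bit_cases[of "par m c"] bit_cases[of "tau m d"]
    by (elim disjE) (simp_all add: ssign_def)
  then show ?thesis
    unfolding 1 2 3 by (simp add: lscale_simps)
qed

definition Aff :: "bit \<Rightarrow> 'a sder set" where
  "Aff d = sder.span {xD a b | a b. a \<in> Y' \<and> b \<in> Y \<and> deg a b = d}"

lemma subspace_Wh: "sder.subspace (Wh d)"
proof (rule sder.subspaceI)
  show "0 \<in> Wh d"
    by (simp add: W_hom_def W_alg_def Lh_linear Lm_linear)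
  show "X + Z \<in> Wh d" if "X \<in> Wh d" "Z \<in> Wh d" for X Z :: "'a sder"
    using that by (auto simp: W_hom_def W_alg_def Lh_linear Lm_linear)
  show "wscale c X \<in> Wh d" if "X \<in> Wh d" for c and X :: "'a sder"
    using that by (auto simp: W_hom_def W_alg_def wscale_def Lh_linear Lm_linear lscale_simps)
qed

lemma Aff_Wh: "X \<in> Aff d \<Longrightarrow> X \<in> Wh d"
  unfolding Aff_def using sder.span_minimal[OF _ subspace_Wh, of "{xD a b | a b. a \<in> Y' \<and> b \<in> Y \<and> deg a b = d}" d] xD_Wh
  by blast

lemma br_zero: "br 0 X = 0" "br X 0 = 0"
  using bracket_linear(3)[of 0 0 X] bracket_linear(4)[of X 0 0]
  by (simp_all add: sder.scale_zero_left)

lemma op_bracket_Aff: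
  assumes X: "X \<in> Aff a" and Z: "Z \<in> Aff b" and f: "f \<in> Lm"
  shows "op (br X Z) f = op X (op Z f) - lscale (s (a * b)) (op Z (op X f))"
proof -
  let ?P = "\<lambda>X Z. op (br X Z) f = op X (op Z f) - lscale (s (a * b)) (op Z (op X f))"
  have lin: "?P (wscale k U + V) Z'" if "?P U Z'" "?P V Z'" for k U V Z'
    using that by (simp add: bracket_linear op_linear lscale_simps mult.commute)
  have lin': "?P Z' (wscale k U + V)" if "?P Z' U" "?P Z' V" for k U V Z'
    using that by (simp add: bracket_linear op_linear lscale_simps mult.commute)
  have zero: "?P 0 U" "?P U 0" for U
    by (simp_all add: br_zero op_zero lscale_simps)
  have 1: "?P X (xD c d)" if cd: "c \<in> Y'" "d \<in> Y" "deg c d = b" for c d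
    using X unfolding Aff_def
  proof (rule sder.span_induct_alt)
    fix k x y assume "x \<in> {xD a' b' | a' b'. a' \<in> Y' \<and> b' \<in> Y \<and> deg a' b' = a}" and y: "?P y (xD c d)"
    then obtain a' b' where x: "x = xD a' b'" "a' \<in> Y'" "b' \<in> Y" "deg a' b' = a" by blast
    show "?P (wscale k x + y) (xD c d)"
      using op_bracket_xD[OF x(2,3) cd(1,2) f] by (intro lin y) (simp add: x cd)
  qed (rule zero)
  show ?thesis
    using Z unfolding Aff_def
  proof (rule sder.span_induct_alt)
    fix k x y assume "x \<in> {xD a' b' | a' b'. a' \<in> Y' \<and> b' \<in> Y \<and> deg a' b' = b}" and y: "?P X y"
    then show "?P X (wscale k x + y)"
      using 1 by (intro lin' y) blast
  qed (rule zero)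
qed

text \<open>Here the two fields are arbitrary but the function is affine. On a generator the claim
  is the coefficient formula for the bracket, by \<open>op_gen1\<close>; the rest is
  linearity.\<close>

lemma op_bracket_coeff_Aff:
  assumes X: "X \<in> Aff a" and U: "U \<in> Wh b" and Z: "Z \<in> Wh c"
  shows "op (br U Z) (X j) = op U (op Z (X j)) - lscale (s (b * c)) (op Z (op U (X j)))"
proof -
  let ?P = "\<lambda>f. op (br U Z) f = op U (op Z f) - lscale (s (b * c)) (op Z (op U f))"
  have lin: "?P (lscale k f + h)" if "?P f" "?P h" for k f h
    using that by (simp add: op_linear lscale_simps mult.commute)
  have zero: "?P 0"
    by (simp add: op_zero lscale_simps)
  have gen: "?P (g d)" if "d \<in> Y'" for d
    using op_gen1[OF U that] op_gen1[OF Z that] op_gen1[OF bracket_hom[OF U Z] that]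
    by (simp add: bracket_eq[OF U Z])
  show ?thesis
    using X unfolding Aff_def
  proof (rule sder.span_induct_alt)
    fix k x y assume "x \<in> {xD d e | d e. d \<in> Y' \<and> e \<in> Y \<and> deg d e = a}" and y: "?P (y j)"
    then obtain d e where x: "x = xD d e" "d \<in> Y'" by blast
    have "?P (x j)" using gen[OF x(2)] zero by (simp add: x(1) xD_def fD_def)
    then have "?P (lscale k (x j) + y j)" by (rule lin) (rule y)
    then show "?P ((wscale k x + y) j)" by (simp add: wscale_def)
  next
    show "?P ((0 :: 'a sder) j)" using zero by simp
  qed
qed

text \<open>In each coefficient, the terms in \<open>X j\<close> and \<open>U j\<close> involve an
  affine function (\<open>op_bracket_coeff_Aff\<close>), and those in \<open>Z j\<close> involve two
  affine fields (\<open>op_bracket_Aff\<close>).\<close>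

lemma jacobi_Aff:
  assumes X: "X \<in> Aff a" and U: "U \<in> Aff b" and Z: "Z \<in> Wh c"
  shows "br X (br U Z) = br (br X U) Z + wscale (s (a * b)) (br U (br X Z))"
proof
  fix j
  note W = Aff_Wh[OF X] Aff_Wh[OF U]
  note b = bracket_hom[OF W(2) Z] bracket_hom[OF W(1) Z] bracket_hom[OF W]
  show "br X (br U Z) j = (br (br X U) Z + wscale (s (a * b)) (br U (br X Z))) j"
    using bit_cases[of a] bit_cases[of b] bit_cases[of c]
    by (elim disjE; simp add: wscale_def bracket_eq[OF W(1) b(1)] bracket_eq[OF W(2) b(2)] bracket_eq[OF b(3) Z]
      op_bracket_coeff_Aff[OF X W(2) Z] op_bracket_coeff_Aff[OF U W(1) Z]
      op_bracket_Aff[OF X U Wh_Lh[OF Z, THEN Lh_Lm]];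
      simp add: bracket_eq[OF W(2) Z] bracket_eq[OF W(1) Z] bracket_eq[OF W] lscale_ssign op_diff op_minus op_linear)
qed

section \<open>Elements of S of degree at most 0\<close>

lemma Y0_Y: "i \<in> Y0 m \<Longrightarrow> i \<in> Y" and Y1_Y: "i \<in> Y1 m n \<Longrightarrow> i \<in> Y"
  by (auto simp: Yall_def)

lemma Y_pos: "i \<in> Y \<Longrightarrow> i \<noteq> 0"
  using zero_notin_Y by metis

text \<open>\<open>m\<close> and \<open>n\<close> are at least 2, so \<open>Y\<close> has at least
  four elements. This supplies the intermediate index in x_a D_b = [x_a D_c, x_c D_b].\<close>

lemma Y_avoid: obtains c where "c \<in> Y" "c \<noteq> a" "c \<noteq> b" "c \<noteq> k"
proof -
  have "card Y = m + n"
    by (auto simp: Yall_def Y0_def Y1_def card_Un_disjoint)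
  moreover have "card {a, b, k} \<le> 3"
    using card_insert_le_m1[of 3 "{b, k}" a] card_insert_le_m1[of 2 "{k}" b] by simp
  ultimately have "card {a, b, k} < card Y"
    using m_ge n_ge by simp
  then have "\<not> Y \<subseteq> {a, b, k}"
    using card_mono[of "{a, b, k}" Y] by auto
  then show thesis using that by auto
qed

lemma Dij_eq:
  assumes f: "f \<in> Lh d" and ij: "i \<in> Y" "j \<in> Y"
  shows "Dij p m n t i j f = - wscale (s (d * (tau m i + tau m j))) (fD (pd m j f) i)
    + wscale (s (tau m i * tau m j)) (fD (pd m i f) j)"
proof -
  have "Dij_hom p m n t i j e 0 = (0::'a sder)" for e
    by (auto simp: Dij_hom_def Dop_zero fD_def wscale_def lscale_def fun_eq_iff)
  then have "Dij p m n t i j f = Dij_hom p m n t i j d f"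
    unfolding Dij_def hpart_Lh[OF f] using bit_cases[of d] by auto
  then show ?thesis
    using Dop_eq_pd[OF Lh_Lm[OF f]] ij by (simp add: Dij_hom_def)
qed

lemma fD_linear: "fD (f + h) i = fD f i + fD h i" "fD (lscale c f) i = wscale c (fD f i)"
  "fD 0 i = (0::'a sder)" for f h :: "'a lam"
  by (auto simp: fD_def wscale_def lscale_simps fun_eq_iff)

lemma Dij_gen1_gen1:
  assumes "i \<in> Y" "j \<in> Y" "c \<in> Y'" "a \<in> Y'"
  shows "Dij p m n t i j (mult (g c) (g a)) =
    - wscale (s ((par m c + par m a) * (tau m i + tau m j)))
        ((if j = c then xD a i else 0) + wscale (s (tau m j * par m c)) (if j = a then xD c i else 0))
    + wscale (s (tau m i * tau m j))
        ((if i = c then xD a j else 0) + wscale (s (tau m i * par m c)) (if i = a then xD c j else 0))"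
proof -
  have "pd m b (mult (g c) (g a)) = (if b = c then g a else 0) + lscale (s (tau m b * par m c)) (if b = a then g c else 0)"
    if "b \<in> Y" for b
    using that assms(3,4) gen1_Lh[OF assms(4), THEN Lh_Lm] Y_pos[OF that]
    by (auto simp: lmult_gen1 pd_xop pd_gen1 xop_gen1_0 xop_zero)
  then show ?thesis
    unfolding Dij_eq[OF lmult_hom[OF gen1_Lh[OF assms(3)] gen1_Lh[OF assms(4)]] assms(1,2)]
    using assms(1,2) by (simp only: fD_linear xD_def[symmetric] if_distrib[of "\<lambda>f. fD f _"] cong: if_cong)
qed

lemma Dij_S: "i \<in> Y \<Longrightarrow> j \<in> Y \<Longrightarrow> f \<in> Lm \<Longrightarrow> Dij p m n t i j f \<in> Sa"
  unfolding S_alg_def by (intro sder.span_base) blast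

lemma S_linear: "X \<in> Sa \<Longrightarrow> wscale c X \<in> Sa" "X \<in> Sa \<Longrightarrow> Z \<in> Sa \<Longrightarrow> X + Z \<in> Sa"
  "X \<in> Sa \<Longrightarrow> Z \<in> Sa \<Longrightarrow> X - Z \<in> Sa" "0 \<in> Sa" "X \<in> Sa \<Longrightarrow> - X \<in> Sa"
  unfolding S_alg_def
  by (simp_all add: sder.span_scale sder.span_add sder.span_diff sder.span_zero sder.span_neg)

lemma ssign_square: "s d * s d = 1"
  by (simp add: ssign_def)

text \<open>With a third index c, the function x_c x_a is killed by D_b, and D_c returns x_a; hence
  only one term of D_bc(x_c x_a) remains.\<close>

lemma xD_S:
  assumes "a \<in> Y'" "b \<in> Y" "a \<noteq> b"
  shows "xD a b \<in> Sa"
proof -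
  obtain c where c: "c \<in> Y" "c \<noteq> a" "c \<noteq> b" by (rule Y_avoid[of a b b])
  let ?e = "s ((par m c + par m a) * (tau m b + tau m c))"
  have "Dij p m n t b c (mult (g c) (g a)) = - wscale ?e (xD a b)"
    using assms c Dij_gen1_gen1[of b c c a] by auto
  then have "xD a b = - wscale ?e (Dij p m n t b c (mult (g c) (g a)))"
    by (simp add: sder.scale_minus_right ssign_square)
  moreover have "Dij p m n t b c (mult (g c) (g a)) \<in> Sa"
    using assms c by (intro Dij_S lmult_Lm) auto
  ultimately show ?thesis
    by (metis S_linear(1,5))
qed

text \<open>The sign is the one that makes the superdivergence of this diagonal field vanish; the
  field is D_ab(x_a x_b) up to sign.\<close>

lemma xD_diag_S:
  assumes "a \<in> Y" "b \<in> Y" "a \<noteq> b"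
  shows "xD a a - wscale (s (tau m a + tau m b)) (xD b b) \<in> Sa"
proof -
  have p: "par m a = tau m a" "par m b = tau m b" using assms Y_pos by (auto simp: par_def)
  have "Dij p m n t a b (mult (g a) (g b)) \<in> Sa"
    using assms by (intro Dij_S lmult_Lm) auto
  moreover have "Dij p m n t a b (mult (g a) (g b)) =
    - wscale (s (tau m a + tau m b)) (wscale (s (tau m b * tau m a)) (xD a a)) + wscale (s (tau m a * tau m b)) (xD b b)"
    using assms Dij_gen1_gen1[of a b a b] bit_cases[of "tau m a"] bit_cases[of "tau m b"]
    by (auto simp: p)
  ultimately have "- wscale (s (tau m a + tau m b) * s (tau m a * tau m b))
     (- wscale (s (tau m a + tau m b)) (wscale (s (tau m b * tau m a)) (xD a a)) + wscale (s (tau m a * tau m b)) (xD b b)) \<in> Sa"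
    by (metis S_linear(1,5))
  then show ?thesis
    using bit_cases[of "tau m a"] bit_cases[of "tau m b"] by (auto simp: ssign_def)
qed

text \<open>Diagonal terms appear only when \<open>b = c\<close> and \<open>d = a\<close>, and then
  in the divergence-free combination of \<open>xD_diag_S\<close>.\<close>

lemma bracket_xD_S:
  assumes "a \<in> Y'" "b \<in> Y" "c \<in> Y'" "d \<in> Y" "a \<noteq> b" "c \<noteq> d"
  shows "br (xD a b) (xD c d) \<in> Sa"
proof (cases "b = c \<and> d = a")
  case True
  then have p: "par m a = tau m a" "par m c = tau m c" using assms Y_pos by (auto simp: par_def)
  have "br (xD a b) (xD c d) = xD a a - wscale (s (tau m a + tau m b)) (xD b b)"
    using True assms bit_cases[of "tau m a"] bit_cases[of "tau m b"]
    by (auto simp: bracket_xD p)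
  then show ?thesis using xD_diag_S True assms by metis
next
  case False
  then show ?thesis
    using assms by (auto simp: bracket_xD S_linear xD_S)
qed

section \<open>The values of a super-biderivation\<close>

lemma bracket_xD_right:
  assumes Z: "Z \<in> Wh d" and ab: "a \<in> Y'" "b \<in> Y"
  shows "br Z (xD a b) l = (if l = b then Z a else 0) - lscale (s (d * deg a b)) (xop m a (pd m b (Z l)))"
  unfolding bracket_eq[OF Z xD_Wh[OF ab]] op_xD[OF Wh_Lh[OF Z, THEN Lh_Lm] ab]
  using op_gen1[OF Z ab(1)] by (simp add: xD_def fD_def op_zero)

lemma centralizer_D:
  assumes Z: "Z \<in> Wh d" and b: "b \<in> Y" and "br Z (xD 0 b) = 0"
  shows "pd m b (Z l) = 0"
proof -
  have "xop m 0 f = f" for f :: "'a lam" by (auto simp: xop_def)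
  moreover have "br Z (xD 0 b) l = 0" using assms by simp
  ultimately show ?thesis
    using Wh_0[OF Z zero_notin_Y(3)]
    by (simp add: bracket_xD_right[OF Z _ b] lscale_ssign split: if_splits)
qed

lemma centralizer_xD:
  assumes Z: "Z \<in> Wh d" and ab: "a \<in> Y" "b \<in> Y" and "br Z (xD 0 b) = 0" "br Z (xD a b) = 0"
  shows "Z a = 0"
proof -
  \<comment> \<open>The coefficient of D_b in the bracket is \<open>Z a\<close> up to a term
    containing \<open>pd m b (Z b)\<close>, which vanishes.\<close>
  have "br Z (xD a b) b = 0" using assms by simp
  then show ?thesis
    using ab centralizer_D[OF Z ab(2) assms(4), of b]
    by (simp add: bracket_xD_right[OF Z _ ab(2)] xop_zero lscale_simps)
qed

text \<open>In divided powers D_b shifts coefficients without integer factors. So any nonconstant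
  monomial in \<open>f\<close> is detected by some D_b, even in characteristic p.\<close>

lemma pd_zero_imp_const:
  assumes f: "f \<in> Lm" and pd: "\<And>b. b \<in> Y \<Longrightarrow> pd m b f = 0"
  shows "f = lscale (f (0, {})) (g 0)"
proof
  fix k :: idx
  obtain \<alpha> u where k: "k = (\<alpha>, u)" by (cases k)
  have "f (\<alpha>, u) = 0" if "(\<alpha>, u) \<noteq> (0, {})"
  proof (rule ccontr)
    assume nz: "f (\<alpha>, u) \<noteq> 0"
    then have I: "(\<alpha>, u) \<in> I" using f by (auto simp: Lam_def)
    have "(\<exists>b. \<alpha> b \<noteq> 0) \<or> (\<exists>b. b \<in> u)" using that by (auto simp: fun_eq_iff)
    then consider b where "\<alpha> b \<noteq> 0" | b where "b \<in> u" by blast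
    then show False
    proof cases
      case 1
      then have b: "b \<in> Y0 m" using I by (auto simp: basis_idx_def multi_idx_def)
      then have "pd m b f (\<alpha>(b := \<alpha> b - 1), u) = f (\<alpha>, u)" using 1 by (simp add: pd_def)
      then show False using pd[OF Y0_Y[OF b]] nz by simp
    next
      case 2
      then have b: "b \<in> Y1 m n" using I by (auto simp: basis_idx_def)
      then have "b \<notin> Y0 m" by (auto simp: Y0_def Y1_def)
      then have "pd m b f (\<alpha>, u - {b}) = isign b (u - {b}) * f (\<alpha>, u)"
        using 2 by (simp add: pd_def insert_absorb)
      then show False using pd[OF Y1_Y[OF b]] nz by (simp add: isign_def)
    qed
  qed
  then show "f k = lscale (f (0, {})) (g 0) k"
    by (auto simp: k lscale_def gen1_def bmono_def)
qed

lemma centralizer: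
  assumes Z: "Z \<in> Wh d" and k: "k \<in> Y" and D: "br Z (xD 0 k) = 0"
    and xD: "\<And>a b. \<lbrakk>a \<in> Y'; b \<in> Y; a \<noteq> b; a \<noteq> k; b \<noteq> k\<rbrakk> \<Longrightarrow> br Z (xD a b) = 0"
  shows "Z = wscale (Z k (0, {})) (xD 0 k)"
proof
  have D': "br Z (xD 0 b) = 0" if "b \<in> Y" for b
    using D xD[of 0 b] that k Y_pos by (cases "b = k") force+
  fix l
  have "Z l = 0" if "l \<noteq> k"
  proof (cases "l \<in> Y")
    case True
    obtain b where b: "b \<in> Y" "b \<noteq> l" "b \<noteq> k" by (rule Y_avoid[of l k k])
    then show ?thesis using True that centralizer_xD[OF Z True b(1) D'] xD by simp
  qed (rule Wh_0[OF Z])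
  moreover have "Z k = lscale (Z k (0, {})) (g 0)"
    using pd_zero_imp_const[OF Wh_Lh[OF Z, THEN Lh_Lm]] centralizer_D[OF Z _ D'] by blast
  ultimately show "Z l = wscale (Z k (0, {})) (xD 0 k) l"
    by (auto simp: wscale_def xD_def fD_def lscale_simps)
qed

section \<open>The biderivation on the torus element and on affine fields\<close>

context
  fixes \<phi> :: "'a sder \<Rightarrow> 'a sder \<Rightarrow> 'a sder" and \<gamma> :: bit and k0 k1 :: nat
  assumes bd: "skew_super_biderivation wscale Sa Sh br \<gamma> \<phi>"
    and k0: "k0 \<in> Y0 m" and k1: "k1 \<in> Y1 m n"
begin

definition h :: "'a sder" where
  "h = xD k0 k0 + xD k1 k1"

text \<open>The single fields x_a D_a are left out because their divergence is nonzero; of the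
  diagonal fields only the even element \<open>h\<close> is included.\<close>

definition B :: "bit \<Rightarrow> 'a sder set" where
  "B d = {xD a b | a b. a \<in> Y' \<and> b \<in> Y \<and> a \<noteq> b \<and> deg a b = d} \<union> (if d = 0 then {h} else {})"

lemma k_simps: "k0 \<in> Y" "k1 \<in> Y" "k0 \<noteq> k1" "k0 \<noteq> 0" "k1 \<noteq> 0" "tau m k0 = 0" "tau m k1 = 1"
  "par m k0 = 0" "par m k1 = 1"
  using k0 k1 Y0_Y Y1_Y by (auto simp: Y0_def Y1_def tau_def par_def)

lemma h_Aff: "h \<in> Aff 0"
  unfolding h_def Aff_def
  by (intro sder.span_add sder.span_base) (use k_simps in force)+

lemma B_Aff: "X \<in> B d \<Longrightarrow> X \<in> Aff d"
  using h_Aff by (auto simp: B_def Aff_def intro: sder.span_base split: if_splits)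

lemma h_S: "h \<in> Sa"
  using xD_diag_S[OF k_simps(1-3)] k_simps by (simp add: h_def ssign_def)

text \<open>\<open>h\<close> acts diagonally on the fields x_c D_d, which keeps its brackets with
  elements of \<open>B\<close> inside S.\<close>

lemma bracket_h_xD:
  assumes "c \<in> Y'" "d \<in> Y"
  shows "\<exists>e. br h (xD c d) = wscale e (xD c d)"
proof -
  have "br h (xD c d) = (if k0 = c then xD k0 d else 0) - (if d = k0 then xD c k0 else 0)
      + (if k1 = c then xD k1 d else 0) - (if d = k1 then xD c k1 else 0)"
    using assms k_simps by (simp add: h_def bracket_linear bracket_xD ssign_def)
  also have "\<dots> = wscale ((if k0 = c then 1 else 0) - (if d = k0 then 1 else 0)
      + (if k1 = c then 1 else 0) - (if d = k1 then 1 else 0)) (xD c d)"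
    by (simp add: sder.scale_left_distrib sder.scale_left_diff_distrib)
  finally show ?thesis by blast
qed

lemma bracket_h_h: "br h h = 0"
  unfolding h_def using k_simps by (simp add: bracket_linear bracket_xD ssign_def)

lemma B_S: "X \<in> B d \<Longrightarrow> X \<in> Sh d"
  using Aff_Wh[OF B_Aff, of X d] by (auto simp: S_hom_def B_def xD_S h_S split: if_splits)

lemma bracket_B_S:
  assumes "X \<in> B c" "Z \<in> B d"
  shows "br X Z \<in> Sa"
proof -
  have hS: "br h (xD a b) \<in> Sa" if "a \<in> Y'" "b \<in> Y" "a \<noteq> b" for a b
    using bracket_h_xD[OF that(1,2)] xD_S[OF that] S_linear(1) by metis
  have hS': "br (xD a b) h \<in> Sa" if "a \<in> Y'" "b \<in> Y" "a \<noteq> b" for a b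
    using bracket_skew[OF xD_Wh[OF that(1,2)] Aff_Wh[OF h_Aff]] hS[OF that] S_linear(1,5) by metis
  show ?thesis
    using assms hS hS' bracket_xD_S
    by (auto simp: B_def bracket_h_h S_linear split: if_splits)
qed

interpretation super_biderivation wscale Sa Sh Wh B br \<phi> \<gamma>
proof
  show "br X Z \<in> Sh (c + d)" if "X \<in> B c" "Z \<in> B d" for X Z c d
    using that bracket_B_S bracket_hom[OF Aff_Wh Aff_Wh, OF B_Aff B_Aff] by (auto simp: S_hom_def)
  show "br X (br U Z) = br (br X U) Z + wscale (s (a * b)) (br U (br X Z))"
    if "X \<in> B a" "U \<in> B b" "Z \<in> Wh c" for X U Z a b c
    by (rule jacobi_Aff[OF B_Aff[OF that(1)] B_Aff[OF that(2)] that(3)])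
  show "br X Z = - wscale (s (a * b)) (br Z X)" if "X \<in> Wh a" "Z \<in> Wh b" for X Z a b
    using that by (rule bracket_skew)
  show "Sh a \<subseteq> Wh a" for a
    by (simp add: S_hom_def)
  show "B a \<subseteq> Sh a" for a
    using B_S by blast
qed (fact bd, (fact bracket_linear)+, rule bracket_hom)

lemma two_nonzero: "(2::'a) \<noteq> 0"
proof
  assume "(2::'a) = 0"
  then have "of_nat 2 = (0::'a)" by simp
  then have "p dvd 2" unfolding of_nat_eq_0_iff_char_dvd char .
  then show False using p_gt by (auto dest: dvd_imp_le)
qed

lemma xD_B: "a \<in> Y' \<Longrightarrow> b \<in> Y \<Longrightarrow> a \<noteq> b \<Longrightarrow> xD a b \<in> B (deg a b)"
  by (auto simp: B_def)

lemma xD_commutator: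
  assumes "a \<in> Y'" "b \<in> Y" "c \<in> Y" "a \<noteq> b"
  shows "br (xD a c) (xD c b) = xD a b"
  using assms by (simp add: bracket_xD)

lemma phi_Wh: "X \<in> B a \<Longrightarrow> Z \<in> B b \<Longrightarrow> \<phi> X Z \<in> Wh (a + b + \<gamma>)"
  using phi_deg B_S by (fastforce simp: S_hom_def)

lemma phi_0: "X \<in> Sa \<Longrightarrow> \<phi> X 0 = 0"
proof -
  assume X: "X \<in> Sa"
  have "\<phi> X (0 + 0) = \<phi> X 0 + \<phi> X 0"
    using biderivation X S_linear(4)
    unfolding skew_super_biderivation_def homogeneous_bilinear_def bilinear_on_def by blast
  then show ?thesis by simp
qed

lemma phi_xD_D:
  assumes "a \<in> Y'" "b \<in> Y" "k \<in> Y" "a \<noteq> b" "a \<noteq> k"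
  shows "\<phi> (xD a b) (xD 0 k) = 0"
proof -
  let ?P = "\<phi> (xD a b) (xD 0 k)"
  have k: "0 \<noteq> k" using assms Y_pos by metis
  have B: "xD a b \<in> B (deg a b)" "xD 0 k \<in> B (deg 0 k)"
    using assms k by (auto intro!: xD_B)
  have "br (xD a b) (xD 0 k) = 0"
    using assms Y_pos by (auto simp: bracket_xD)
  then have cent: "br ?P (xD c d) = 0" if cd: "c \<in> Y'" "d \<in> Y" "c \<noteq> d" for c d
  proof -
    obtain e where e: "e \<in> Y" "e \<noteq> c" "e \<noteq> d" by (rule Y_avoid[of c d d])
    show ?thesis
      using phi_bracket[OF two_nonzero B xD_B[of c e] xD_B[of e d]] cd e \<open>br (xD a b) (xD 0 k) = 0\<close>
      by (simp add: xD_commutator br_zero)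
  qed
  \<comment> \<open>\<open>centralizer\<close> alone leaves a multiple of D_k. Commuting with x_k
    D_b' as well makes that multiple zero.\<close>
  obtain b' where b': "b' \<in> Y" "b' \<noteq> k" "b' \<noteq> k" by (rule Y_avoid[of k k k])
  have "?P k = 0"
    using centralizer_xD[OF phi_Wh[OF B] assms(3) b'(1)] cent b' assms(3) Y_pos[OF b'(1)] by force
  then have P0: "?P k (0, {}) = 0" by simp
  have "?P = wscale (?P k (0, {})) (xD 0 k)"
    by (rule centralizer[OF phi_Wh[OF B] assms(3)]) (use cent assms(3) k in auto)
  then have "?P = wscale 0 (xD 0 k)" unfolding P0 .
  then show ?thesis by simp
qed

lemma phi_h_D: "\<exists>c. \<phi> h (xD 0 k1) = wscale c (xD 0 k1)"
proof -
  let ?D = "xD 0 k1" and ?P = "\<phi> h (xD 0 k1)"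
  have B: "h \<in> B 0" "?D \<in> B 1"
    using xD_B[of 0 k1] k_simps by (simp_all add: B_def[of 0] par_def)
  have P: "?P \<in> Wh (1 + \<gamma>)" using phi_Wh[OF B] by simp
  have "br ?D ?D = 0" using k_simps by (simp add: bracket_xD)
  \<comment> \<open>This is the derivation rule for \<open>\<phi> h (br ?D ?D)\<close>. As
    \<open>?D\<close> is odd, super-skew-symmetry makes the two terms equal for either value of
    \<open>\<gamma>\<close>, so they add up to 2 [P, D].\<close>
  then have "br ?P ?D + wscale (s \<gamma>) (br ?D ?P) = 0"
    using phi_der[OF B_S[OF B(1)] B_S[OF B(2)] B_S[OF B(2)]] phi_0[OF h_S] by simp
  then have "wscale 2 (br ?P ?D) = 0"
    unfolding bracket_skew[OF Aff_Wh[OF B_Aff[OF B(2)]] P]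
    using bit_cases[of \<gamma>] sder.scale_left_distrib[of 1 1 "br ?P ?D"]
    by (elim disjE) (simp_all add: ssign_def)
  then have PD: "br ?P ?D = 0" using two_nonzero by simp
  have hD: "br h ?D = - ?D"
    using k_simps by (simp add: h_def bracket_linear bracket_xD ssign_def par_def)
  have "br ?P (xD a b) = 0" if ab: "a \<in> Y'" "b \<in> Y" "a \<noteq> b" "a \<noteq> k1" "b \<noteq> k1" for a b
  proof -
    obtain c where c: "c \<in> Y" "c \<noteq> a" "c \<noteq> b" "c \<noteq> k1" by (rule Y_avoid)
    have uv: "xD a c \<in> B (deg a c)" "xD c b \<in> B (deg c b)"
      using ab c by (auto intro!: xD_B)
    have "br ?D (xD c b) = 0"
      using ab c k_simps Y_pos[OF ab(2)] by (simp add: bracket_xD)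
    moreover have "\<phi> (xD a c) ?D = 0" "\<phi> (xD a c) 0 = 0"
      using phi_xD_D[OF ab(1) c(1) k_simps(2) c(2)[symmetric] ab(4)]
        phi_0[OF xD_S[OF ab(1) c(1) c(2)[symmetric]]] by simp_all
    \<comment> \<open>The derivation rule for \<open>\<phi> (xD a c) (br ?D (xD c b))\<close>: the
      left side and the first term on the right are both zero, so the second term is zero
      too.\<close>
    ultimately have "wscale (s ((\<gamma> + deg a c) * 1)) (br ?D (\<phi> (xD a c) (xD c b))) = 0"
      using phi_der[OF B_S[OF uv(1)] B_S[OF B(2)] B_S[OF uv(2)]] by (simp only: br_zero add_0_left)
    then have "br ?D (\<phi> (xD a c) (xD c b)) = 0"
      by (auto simp: ssign_def split: if_splits)
    then show ?thesis
      using phi_bracket[OF two_nonzero B uv]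
      unfolding xD_commutator[OF ab(1,2) c(1) ab(3)] hD br_minus by simp
  qed
  then have const: "?P = wscale (?P k1 (0, {})) ?D"
    by (rule centralizer[OF P k_simps(2) PD])
  show ?thesis
    by (rule exI) (rule const)
qed

end

theorem phi_torus_translation:
  assumes bd: "skew_super_biderivation wscale Sa Sh br \<gamma> \<phi>"
    and k0: "k0 \<in> Y0 m" and k1: "k1 \<in> Y1 m n"
  shows "\<exists>\<mu>. \<forall>i1\<in>Y1 m n. i1 \<noteq> k1 \<longrightarrow>
    \<phi> (Dij p m n t k0 k1 (mult (gen m k0) (gen m k1))) (Dij p m n t k1 i1 (gen m i1)) =
    wscale \<mu> (br (Dij p m n t k0 k1 (mult (gen m k0) (gen m k1))) (Dij p m n t k1 i1 (gen m i1)))"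
proof -
  note k = k_simps[OF bd k0 k1]
  let ?h = "h k0 k1"
  have gen: "gen m i = g i" if "i \<in> Y" for i
    using Y_pos[OF that] by (simp add: gen1_def)
  have h: "Dij p m n t k0 k1 (mult (gen m k0) (gen m k1)) = ?h"
    using Dij_gen1_gen1[of k0 k1 k0 k1] k by (simp add: gen h_def[OF bd k0 k1] ssign_def)
  \<comment> \<open>The value does not involve \<open>i1\<close>, which is why the scalar depends on
    \<open>k0\<close> and \<open>k1\<close> only.\<close>
  have D: "Dij p m n t k1 i1 (gen m i1) = - xD 0 k1" if i1: "i1 \<in> Y1 m n" "i1 \<noteq> k1" for i1
  proof -
    have i: "i1 \<in> Y" "i1 \<noteq> 0" "tau m i1 = 1" "par m i1 = 1" "par m 0 = 0"
      using i1 Y1_Y by (auto simp: Y0_def Y1_def tau_def par_def)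
    have "mult (g i1) (g 0) = g i1"
      using i gen1_Lh[of i1] by (intro lmult_one) (auto intro: Lh_Lm)
    then show ?thesis
      using Dij_gen1_gen1[of k1 i1 i1 0] k i i1 by (simp add: gen ssign_def)
  qed
  obtain c where c: "\<phi> ?h (xD 0 k1) = wscale c (xD 0 k1)"
    using phi_h_D[OF bd k0 k1] by blast
  have "\<phi> ?h (- xD 0 k1) = - \<phi> ?h (xD 0 k1)"
  proof -
    have "\<phi> ?h (wscale (- 1) (xD 0 k1)) = wscale (- 1) (\<phi> ?h (xD 0 k1))"
      using bd h_S[OF bd k0 k1] xD_S[of 0 k1] k
      unfolding skew_super_biderivation_def homogeneous_bilinear_def bilinear_on_def by blast
    then show ?thesis by simp
  qed
  moreover have "br ?h (- xD 0 k1) = xD 0 k1"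
  proof -
    have "br ?h (wscale (- 1) (xD 0 k1)) = xD 0 k1"
      unfolding bracket_linear
      using k by (simp add: h_def[OF bd k0 k1] bracket_linear bracket_xD ssign_def par_def)
    then show ?thesis by simp
  qed
  ultimately show ?thesis
    \<comment> \<open>The scalar is \<open>- c\<close> because \<open>\<phi>\<close> sends (h,
      -D_k1) to -c D_k1, while [h, -D_k1] = D_k1.\<close>
    unfolding h using D c by (intro exI[of _ "- c"]) simp
qed

end

theorem lemma4p8:
  fixes \<phi> :: "'a::field sder \<Rightarrow> 'a sder \<Rightarrow> 'a sder"
    and p m n :: nat and t :: "nat \<Rightarrow> nat" and \<gamma> :: bit
  assumes "CHAR('a) = p" and "p > 2"
    and "m \<ge> 2" and "n \<ge> 2"
    and "\<And>i. i \<in> Y0 m \<Longrightarrow> t i > 0"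
    and "skew_super_biderivation wscale (S_alg p m n t) (S_hom p m n t) (bracket p m n t) \<gamma> \<phi>"
  shows "\<exists>\<mu> :: nat \<Rightarrow> nat \<Rightarrow> 'a. \<forall>k0\<in>Y0 m. \<forall>k1\<in>Y1 m n. \<forall>i1\<in>Y1 m n. i1 \<noteq> k1 \<longrightarrow>
    \<phi> (Dij p m n t k0 k1 (lmult p m n t (gen m k0) (gen m k1))) (Dij p m n t k1 i1 (gen m i1))
    = wscale (\<mu> k0 k1)
        (bracket p m n t
          (Dij p m n t k0 k1 (lmult p m n t (gen m k0) (gen m k1))) (Dij p m n t k1 i1 (gen m i1)))"
proof -
  interpret special_superalgebra p m n t "TYPE('a)"
    using assms(1-5) by unfold_locales
  show ?thesis
    using phi_torus_translation[OF assms(6)] by metis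
qed

end
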